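(* The array of sets $Y_{TL}(n;l)=D_l(n,l)$, for $n\in\mathbb N$ and $l\in\{0,1,2,\dots\}$ a vertex of $A_\infty$, is a Pascal $(A_\infty,0)$-array, where the edge map for the edge from $i$ to $i+1$ is $\phi^1$ and the edge map for the edge from $i+1$ to $i$ is $\phi^u$ (for all $i\ge 0$). Moreover this array underlies the sequence $(D(n,n))_{n\in\mathbb N}$: cutting the propagating lines gives a bijection $D(n,n)\to\bigsqcup_{l}D_l(n,l)\times D_l(l,n)$ for every $n$, so that $(D(n,n))_n$ is a Catalan $(A_\infty,0)$-sequence with underlying Pascal array $Y_{TL}$.
   Context: $\mathbb N=\{0,1,2,\dots\}$. $A_\infty$ is the undirected graph with vertices $0,1,2,\dots$ and an edge between $i$ and $i+1$ for each $i\ge0$ (an undirected edge is regarded as two opposite directed edges). Pascal arrays. For a rooted graph $(G,v_0)$ with vertices $V$, directed edges $E$, and initial/final maps $i,f:E\to V$, a Pascal $(G,v_0)$-array is a family of sets $Y(n;v)$, $n\in\mathbb N$, $v\in V$, with $Y(0;v_0)$ a singleton and $Y(0;v)=\emptyset$ for $v\neq v_0$, together with injective edge maps $\phi'_e:Y(n-1;i(e))\hookrightarrow Y(n;f(e))$ ($e\in E$, $n\ge1$) such that $Y(n;v)=\bigsqcup_{e:\,f(e)=v}\phi'_e(Y(n-1;i(e)))$ (disjoint union). For undirected $G$, a sequence of sets $(\mathcal C(n))_n$ is a Catalan $(G,v_0)$-sequence with underlying array $Y$ if there are bijections $\mathcal C(n)\cong\bigsqcup_{v}Y(n;v)\times Y'(n;v)$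 for all $n$, with $Y$ and $Y'$ Pascal $(G,v_0)$-arrays. Diagrams. $D(m,n)$ is the set of non-crossing pair partitions of $m+n$ points placed on the boundary of a rectangle, $m$ on the northern edge and $n$ on the southern edge (non-crossing: the pairs can be joined simultaneously by non-crossing lines inside the rectangle). A pair (line) is propagating if it joins a northern to a southern point. $D_l(m,n)\subseteq D(m,n)$ is the set of diagrams with exactly $l$ propagating lines. Thus in an element of $D_l(n,l)$ (an "upper half diagram") every southern point lies on a propagating line; similarly $D_l(l,n)$. $\phi^1:D_l(n,l)\to D_{l+1}(n+1,l+1)$ adds a new northern point and a new southern point at the far right, joined by a new propagating line. For $l>0$, $\phi^u:D_l(n,l)\to D_{l-1}(n+1,l-1)$ moves the rightmost southern point to become a new rightmost northern point, keeping the same pair partition (i.e. bends over the rightmost propagating line). Cutting: a diagram in $D(n,n)$ with exactly $l$ propagating lines is cut from east to west so that each propagating line is cut once and no other line is cut, giving an upper half in $D_l(n,l)$ and a lower half in $D_l(l,n)$. *)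

theory Defs
  imports
    "HOL-Analysis.Analysis"
    "HOL-Library.Disjoint_Sets"
    "Graph_Theory.Bidirected_Digraph"
begin

section \<open>Pascal arrays and Catalan sequences\<close>

text \<open>
  A family of sets \<open>Y(n;v)\<close> is modelled by subsets of one element type.  The map \<open>\<phi> e n\<close> is
  the edge map along \<open>e\<close> from \<open>Y(n; tail e)\<close> to \<open>Y(n + 1; head e)\<close>.
\<close>

definition pascal_array ::
  "('v, 'e) pre_digraph \<Rightarrow> 'v \<Rightarrow> (nat \<Rightarrow> 'v \<Rightarrow> 'y set) \<Rightarrow> ('e \<Rightarrow> nat \<Rightarrow> 'y \<Rightarrow> 'y) \<Rightarrow> bool" where
  "pascal_array G v0 Y \<phi> \<longleftrightarrow>
     wf_digraph G \<and> v0 \<in> verts G \<and>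
     is_singleton (Y 0 v0) \<and>
     (\<forall>v\<in>verts G. v \<noteq> v0 \<longrightarrow> Y 0 v = {}) \<and>
     (\<forall>n. \<forall>e\<in>arcs G.
        \<phi> e n \<in> Y n (tail G e) \<rightarrow> Y (Suc n) (head G e) \<and> inj_on (\<phi> e n) (Y n (tail G e))) \<and>
     (\<forall>n. \<forall>v\<in>verts G.
        Y (Suc n) v = (\<Union>e\<in>in_arcs G v. \<phi> e n ` Y n (tail G e)) \<and>
        disjoint_family_on (\<lambda>e. \<phi> e n ` Y n (tail G e)) (in_arcs G v))"

text \<open>
  An undirected graph is a bidirected digraph: the arcs come in pairs of opposite arcs.  The second
  array \<open>Y'\<close> is taken over the same element type as \<open>Y\<close>.  This is no restriction: by induction on
  \<open>n\<close>, any two Pascal arrays for the same rooted graph have equinumerous entries, so that \<open>Y\<close>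
  itself can always serve as \<open>Y'\<close>.
\<close>

definition catalan_sequence ::
  "('v, 'e) pre_digraph \<Rightarrow> 'v \<Rightarrow> (nat \<Rightarrow> 'c set) \<Rightarrow> (nat \<Rightarrow> 'v \<Rightarrow> 'y set) \<Rightarrow>
     ('e \<Rightarrow> nat \<Rightarrow> 'y \<Rightarrow> 'y) \<Rightarrow> bool" where
  "catalan_sequence G v0 C Y \<phi> \<longleftrightarrow>
     (\<exists>rev. bidirected_digraph G rev) \<and>
     pascal_array G v0 Y \<phi> \<and>
     (\<exists>(Y' :: nat \<Rightarrow> 'v \<Rightarrow> 'y set) \<phi>'. pascal_array G v0 Y' \<phi>' \<and>
        (\<forall>n. \<exists>h. bij_betw h (C n) (SIGMA v:verts G. Y n v \<times> Y' n v)))"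

definition A_inf :: "(nat, nat \<times> nat) pre_digraph" where
  "A_inf = \<lparr>verts = UNIV, arcs = {(i, j). j = Suc i \<or> i = Suc j}, tail = fst, head = snd\<rparr>"


section \<open>Diagrams\<close>

text \<open>\<open>North i\<close> and \<open>South j\<close> are numbered from west to east, starting with 0.\<close>

datatype point = North nat | South nat

definition points :: "nat \<Rightarrow> nat \<Rightarrow> point set" where
  "points m n = North ` {..<m} \<union> South ` {..<n}"

fun position :: "point \<Rightarrow> real ^ 2" where
  "position (North i) = vector [real i + 1, 1]"
| "position (South j) = vector [real j + 1, 0]"

definition rectangle :: "nat \<Rightarrow> nat \<Rightarrow> (real ^ 2) set" where
  "rectangle m n = cbox (vector [0, 0]) (vector [real (max m n) + 1, 1])"

text \<open>
  In a drawing, the line \<open>\<gamma> B\<close> joins the two points of the pair \<open>B\<close> by a simple arc that runs,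
  except for its end points, in the interior of the rectangle.
\<close>

definition drawing :: "nat \<Rightarrow> nat \<Rightarrow> point set set \<Rightarrow> (point set \<Rightarrow> real \<Rightarrow> real ^ 2) \<Rightarrow> bool" where
  "drawing m n d \<gamma> \<longleftrightarrow>
     (\<forall>B\<in>d. arc (\<gamma> B) \<and>
        {pathstart (\<gamma> B), pathfinish (\<gamma> B)} = position ` B \<and>
        path_image (\<gamma> B) - position ` B \<subseteq> interior (rectangle m n)) \<and>
     disjoint_family_on (\<lambda>B. path_image (\<gamma> B)) d"

definition non_crossing :: "nat \<Rightarrow> nat \<Rightarrow> point set set \<Rightarrow> bool" where
  "non_crossing m n d \<longleftrightarrow> (\<exists>\<gamma>. drawing m n d \<gamma>)"

definition diagrams :: "nat \<Rightarrow> nat \<Rightarrow> point set set set" where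
  "diagrams m n =
     {d. partition_on (points m n) d \<and> (\<forall>B\<in>d. card B = 2) \<and> non_crossing m n d}"

definition propagating :: "point set \<Rightarrow> bool" where
  "propagating B \<longleftrightarrow> (\<exists>i j. B = {North i, South j})"

definition diagrams_prop :: "nat \<Rightarrow> nat \<Rightarrow> nat \<Rightarrow> point set set set" where
  "diagrams_prop l m n = {d \<in> diagrams m n. card {B \<in> d. propagating B} = l}"

definition Y_TL :: "nat \<Rightarrow> nat \<Rightarrow> point set set set" where
  "Y_TL n l = diagrams_prop l n l"


section \<open>The edge maps\<close>

definition phi_one :: "nat \<Rightarrow> nat \<Rightarrow> point set set \<Rightarrow> point set set" where
  "phi_one n l d = insert {North n, South l} d"

text \<open>Only meaningful for \<open>l > 0\<close>: the rightmost southern point \<open>South (l - 1)\<close> is relabelled.\<close>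

definition phi_u :: "nat \<Rightarrow> nat \<Rightarrow> point set set \<Rightarrow> point set set" where
  "phi_u n l d = (`) (\<lambda>p. if p = South (l - 1) then North n else p) ` d"

definition edge_map_TL :: "nat \<times> nat \<Rightarrow> nat \<Rightarrow> point set set \<Rightarrow> point set set" where
  "edge_map_TL e n = (if snd e = Suc (fst e) then phi_one n (fst e) else phi_u n (fst e))"


section \<open>Cutting\<close>

text \<open>
  The cut meets the propagating lines in their order from west to east.  So on the propagating line
  with northern end point \<open>North i\<close> the cut point has, counting from the west and starting with 0,
  the number \<open>cut_point d i\<close>, the number of propagating lines further west.  The cut point becomes
  a southern point of the upper half and a northern point of the lower half.
\<close>

definition cut_point :: "point set set \<Rightarrow> nat \<Rightarrow> nat" where
  "cut_point d i = card {i'. i' < i \<and> (\<exists>j'. {North i', South j'} \<in> d)}"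

definition upper_half :: "point set set \<Rightarrow> point set set" where
  "upper_half d =
     {B \<in> d. B \<subseteq> range North} \<union>
     {{North i, South (cut_point d i)} | i j. {North i, South j} \<in> d}"

definition lower_half :: "point set set \<Rightarrow> point set set" where
  "lower_half d =
     {B \<in> d. B \<subseteq> range South} \<union>
     {{North (cut_point d i), South j} | i j. {North i, South j} \<in> d}"

definition cut_diagram :: "point set set \<Rightarrow> nat \<times> point set set \<times> point set set" where
  "cut_diagram d = (card {B \<in> d. propagating B}, upper_half d, lower_half d)"

end

theory Submission
  imports Defs
begin

text \<open>
  Whether a pair partition of the boundary points can be drawn without crossings depends only on
  the cyclic order of the points along the boundary of the rectangle.  Cutting that cycle open at
  the eastern side gives a linear order, and the partition is drawable if and only if no two of its
  pairs alternate in this order (\<open>diagrams_iff\<close>).  Alternating pairs force an intersection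
  because the strip containing the rectangle can be folded into a half-plane so that all
  boundary points land on one line, where the theorem that arcs with alternating ends in the edge of
  a box meet applies (\<open>drawing_imp_unlinked\<close>).  Conversely, pairs that do not alternate
  are drawn simultaneously by straight propagating lines and by parabolas that are so flat that they
  stay away from all other lines (\<open>unlinked_imp_drawing\<close>).  Everything else is combinatorics of
  pairings.

  \<^item> A diagram from \<open>n\<close> to \<open>l\<close> points has \<open>l\<close> propagating lines exactly if no two southern points
    are paired (\<open>upper_diagrams_iff\<close>).  The last northern point of such a diagram is paired either
    with a southern point, which then has to be the last one, or with a northern point.
    The diagrams of the first kind are the values of \<open>phi_one\<close> (\<open>phi_one_image\<close>).  Those of the
    second kind are the values of \<open>phi_u\<close> (\<open>phi_u_image\<close>), because bending the eastern end of the
    boundary back only moves the largest element of the boundary order to the smallest place,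
    and this changes no alternation (\<open>unlinked_rotate\<close>).  So the upper
    halves form a Pascal array.

  \<^item> Turning diagrams upside down carries this Pascal array to the lower halves.

  \<^item> Propagating lines keep their order from north to south.  So the number of a cut point
    determines its line, and the inverse of cutting glues the \<open>k\<close>-th line of the upper half to
    the \<open>k\<close>-th line of the lower half (\<open>glue_cut\<close>, \<open>upper_half_glue\<close>, \<open>lower_half_glue\<close>).
\<close>

section \<open>Pairings\<close>

definition pairing :: "'a set \<Rightarrow> 'a set set \<Rightarrow> bool" where
  "pairing S d \<longleftrightarrow> partition_on S d \<and> (\<forall>B\<in>d. card B = 2)"

lemma pairing_blockE:
  assumes "pairing S d" "B \<in> d"
  obtains p q where "B = {p, q}" "p \<noteq> q" "p \<in> S" "q \<in> S"
  using assms by (fastforce simp: pairing_def card_2_iff partition_on_def)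

lemma pairing_blocks_meet:
  assumes "pairing S d" "{p, q} \<in> d" "{p, r} \<in> d"
  shows "q = r"
proof -
  have "disjoint d"
    using assms(1) by (simp add: pairing_def partition_on_def)
  from disjointD[OF this assms(2,3)] have "{p, q} = {p, r}"
    by auto
  then show ?thesis by (auto simp: doubleton_eq_iff)
qed

lemma pairing_in:
  assumes "pairing S d" "{p, q} \<in> d"
  shows "p \<in> S" "q \<in> S" "p \<noteq> q"
proof -
  show "p \<in> S" "q \<in> S"
    using assms by (auto simp: pairing_def partition_on_def)
  have "card {p, q} = 2"
    using assms by (auto simp: pairing_def simp del: card_insert_disjoint)
  then show "p \<noteq> q" by auto
qed

lemma pairing_partner:
  assumes "pairing S d" "p \<in> S"
  obtains q where "{p, q} \<in> d"
proof -
  obtain B where B: "B \<in> d" "p \<in> B"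
    using assms by (auto simp: pairing_def partition_on_def)
  obtain a b where "B = {a, b}"
    using pairing_blockE[OF assms(1) B(1)] by blast
  then show thesis
    using B that by (auto simp: insert_commute)
qed

text \<open>
  A pairing is handled through the symmetric relation that two points form a pair.  In these terms
  it is a relation under which every point has exactly one partner, other than itself.
\<close>

lemma pairingI:
  assumes blocks: "\<And>B. B \<in> d \<Longrightarrow> \<exists>p q. B = {p, q} \<and> p \<noteq> q \<and> p \<in> S \<and> q \<in> S"
    and total: "\<And>p. p \<in> S \<Longrightarrow> \<exists>q. {p, q} \<in> d"
    and unique: "\<And>p q r. {p, q} \<in> d \<Longrightarrow> {p, r} \<in> d \<Longrightarrow> q = r"
  shows "pairing S d"
  unfolding pairing_def
proof (intro conjI partition_onI ballI)
  show "card B = 2" if "B \<in> d" for B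
    using blocks[OF that] by auto
  show "{} \<notin> d"
    using blocks by blast
next
  show "\<Union> d = S"
    using blocks total by blast
next
  fix B C assume B: "B \<in> d" and C: "C \<in> d" and "B \<noteq> C"
  have *: "\<exists>q. B = {p, q}" if "p \<in> B" "B \<in> d" for p B
    using blocks[OF that(2)] that(1) by (auto simp: insert_commute)
  show "disjnt B C"
    unfolding disjnt_iff
  proof (intro allI notI, elim conjE)
    fix p assume "p \<in> B" "p \<in> C"
    obtain q where "B = {p, q}"
      using *[OF \<open>p \<in> B\<close> B] by blast
    moreover obtain r where "C = {p, r}"
      using *[OF \<open>p \<in> C\<close> C] by blast
    ultimately show False
      using unique[of p q r] B C \<open>B \<noteq> C\<close> by auto
  qed
qed

text \<open>
  All blocks have the form \<open>{p, q}\<close>, so pairings can be compared pair by pair.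
\<close>

lemma pairing_ext:
  assumes "pairing S d" "pairing T e" "\<And>p q. {p, q} \<in> d \<longleftrightarrow> {p, q} \<in> e"
  shows "d = e"
proof (intro set_eqI iffI)
  fix B
  show "B \<in> e" if "B \<in> d"
    using pairing_blockE[OF assms(1) that] assms(3) that by metis
  show "B \<in> d" if "B \<in> e"
    using pairing_blockE[OF assms(2) that] assms(3) that by metis
qed

lemma pairing_image:
  assumes "pairing S d" "inj_on f S"
  shows "pairing (f ` S) ((`) f ` d)"
proof -
  have "card (f ` B) = 2" if "B \<in> d" for B
  proof -
    have "B \<subseteq> S" using assms that by (auto simp: pairing_def partition_on_def)
    then show ?thesis
      using assms that by (simp add: pairing_def card_image inj_on_subset)
  qed
  moreover have "{} \<notin> (`) f ` d"
    using assms(1) by (auto simp: pairing_def partition_on_def)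
  ultimately show ?thesis
    using assms partition_on_inj_image[of S d f] by (auto simp: pairing_def)
qed

lemma pairing_image_id:
  assumes "pairing S d" "\<And>p. p \<in> S \<Longrightarrow> f (g p) = p"
  shows "(`) f ` (`) g ` d = d"
proof -
  have "f ` g ` B = B" if "B \<in> d" for B
  proof -
    have "B \<subseteq> S" using assms that by (auto simp: pairing_def partition_on_def)
    then show ?thesis using assms(2) by (auto simp: image_image subset_iff)
  qed
  then show ?thesis by (simp add: image_image)
qed

lemma image_pairE:
  assumes "{p', q'} \<in> (`) f ` d" "pairing S d"
  obtains p q where "{p, q} \<in> d" "p' = f p" "q' = f q"
proof -
  obtain B where B: "B \<in> d" "{p', q'} = f ` B" using assms(1) by auto
  obtain p q where "B = {p, q}" using pairing_blockE[OF assms(2) B(1)] by blast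
  with B that[of p q] that[of q p] show thesis
    by (auto simp: doubleton_eq_iff insert_commute)
qed

lemma pairing_insert:
  assumes "pairing S d" "p \<notin> S" "q \<notin> S" "p \<noteq> q"
  shows "pairing (insert p (insert q S)) (insert {p, q} d)"
proof -
  have S: "\<Union> d = S"
    using assms by (simp add: pairing_def partition_on_def)
  have "disjnt {p, q} B" if "B \<in> d" for B
    using that assms S by (auto simp: disjnt_def)
  then have "disjoint (insert {p, q} d)"
    using assms(1) by (simp add: pairwise_insert pairing_def partition_on_def disjnt_sym)
  moreover have "\<Union> (insert {p, q} d) = insert p (insert q S)"
    using S by auto
  ultimately show ?thesis
    using assms by (auto simp: pairing_def partition_on_def)
qed

lemma pairing_delete:
  assumes "pairing S d" "{p, q} \<in> d"
  shows "pairing (S - {p, q}) (d - {{p, q}})"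
proof -
  have S: "\<Union> d = S" and disj: "disjoint d" and "{} \<notin> d"
    using assms by (simp_all add: pairing_def partition_on_def)
  have "B \<inter> {p, q} = {}" if "B \<in> d" "B \<noteq> {p, q}" for B
    using disjointD[OF disj that(1) assms(2) that(2)] .
  then have "\<Union> (d - {{p, q}}) = S - {p, q}"
    using S assms(2) by blast
  then show ?thesis
    using assms(1) disj \<open>{} \<notin> d\<close> by (auto simp: pairing_def partition_on_def disjoint_def)
qed

section \<open>The boundary order\<close>

text \<open>
  The boundary is walked from the eastern end of the northern edge to its western end, then down the
  western side, and along the southern edge to the east.  As the places of the northern
  points are negative, every new point that is added in the east gets an extreme place, and no
  place depends on the number of points.
\<close>

fun place :: "point \<Rightarrow> int" where
  "place (North i) = - int i - 1"
| "place (South j) = int j"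

lemma place_eq_iff [simp]: "place p = place q \<longleftrightarrow> p = q"
  by (cases p; cases q) auto

text \<open>
  The combinatorial counterpart of drawability.  Pairs that alternate along the boundary are linked,
  like the ends of two lines that have to meet.
\<close>

definition unlinked :: "point set set \<Rightarrow> bool" where
  "unlinked d \<longleftrightarrow>
     (\<forall>p q r s. {p, q} \<in> d \<longrightarrow> {r, s} \<in> d \<longrightarrow>
       place p < place r \<longrightarrow> place r < place q \<longrightarrow> \<not> place q < place s)"

lemma unlinkedD:
  "unlinked d \<Longrightarrow> {p, q} \<in> d \<Longrightarrow> {r, s} \<in> d \<Longrightarrow>
     place p < place r \<Longrightarrow> place r < place q \<Longrightarrow> \<not> place q < place s"
  by (auto simp: unlinked_def)

lemma South_North_commute [simp]: "{South j, North i} = {North i, South j}"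
  by (rule insert_commute)

text \<open>
  Northern points precede southern points, and their order is reversed.  This leaves five patterns
  of alternating pairs; written out, they no longer involve places.
\<close>

lemma unlinkedI:
  assumes NN_NN: "\<And>a b c e. {North a, North b} \<in> d \<Longrightarrow> {North c, North e} \<in> d \<Longrightarrow>
      a < c \<Longrightarrow> c < b \<Longrightarrow> b < e \<Longrightarrow> False"
    and NN_NS: "\<And>a b c j. {North a, North b} \<in> d \<Longrightarrow> {North c, South j} \<in> d \<Longrightarrow>
      a < c \<Longrightarrow> c < b \<Longrightarrow> False"
    and NS_NS: "\<And>a b j k. {North a, South j} \<in> d \<Longrightarrow> {North b, South k} \<in> d \<Longrightarrow>
      a < b \<Longrightarrow> k < j \<Longrightarrow> False"
    and SS_NS: "\<And>j k a c. {South j, South k} \<in> d \<Longrightarrow> {North a, South c} \<in> d \<Longrightarrow>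
      j < c \<Longrightarrow> c < k \<Longrightarrow> False"
    and SS_SS: "\<And>a b c e. {South a, South b} \<in> d \<Longrightarrow> {South c, South e} \<in> d \<Longrightarrow>
      a < c \<Longrightarrow> c < b \<Longrightarrow> b < e \<Longrightarrow> False"
  shows "unlinked d"
  unfolding unlinked_def
proof (intro allI impI notI)
  fix p q r s
  assume pq: "{p, q} \<in> d" and rs: "{r, s} \<in> d"
    and less: "place p < place r" "place r < place q" "place q < place s"
  consider p' q' r' s' where "p = North p'" "q = North q'" "r = North r'" "s = North s'"
    | p' q' r' s' where "p = North p'" "q = North q'" "r = North r'" "s = South s'"
    | p' q' r' s' where "p = North p'" "q = South q'" "r = North r'" "s = South s'"
    | p' q' r' s' where "p = North p'" "q = South q'" "r = South r'" "s = South s'"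
    | p' q' r' s' where "p = South p'" "q = South q'" "r = South r'" "s = South s'"
    using less by (cases p; cases q; cases r; cases s) auto
  then show False
  proof cases
    case 1
    then show False
      using NN_NN[of s' r' q' p'] pq rs less by (simp add: insert_commute)
  next
    case 2
    then show False
      using NN_NS[of q' p' r' s'] pq rs less by (simp add: insert_commute)
  next
    case 3
    then show False
      using NS_NS[of r' s' p' q'] pq rs less by simp
  next
    case 4
    then show False
      using SS_NS[of r' s' p' q'] pq rs less by simp
  next
    case 5
    then show False
      using SS_SS[of p' q' r' s'] pq rs less by simp
  qed
qed

lemma unlinked_subset: "unlinked d \<Longrightarrow> e \<subseteq> d \<Longrightarrow> unlinked e"
  unfolding unlinked_def by blast

text \<open>
  Alternation is a property of the cyclic order: if \<open>p < r < q < s\<close> alternate and the largest point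
  \<open>s\<close> becomes the smallest, then the pairs \<open>{s, r}\<close> and \<open>{p, q}\<close> alternate instead.
\<close>

lemma unlinked_rotate:
  assumes d: "pairing S d" and m: "m \<in> S"
    and max: "\<And>p. p \<in> S \<Longrightarrow> p \<noteq> m \<Longrightarrow> place p < place m"
    and min: "\<And>p. p \<in> S \<Longrightarrow> p \<noteq> m \<Longrightarrow> place (f m) < place (f p)"
    and mono: "\<And>p q. p \<in> S \<Longrightarrow> q \<in> S \<Longrightarrow> p \<noteq> m \<Longrightarrow> q \<noteq> m \<Longrightarrow>
      place (f p) < place (f q) \<longleftrightarrow> place p < place q"
  shows "unlinked ((`) f ` d) \<longleftrightarrow> unlinked d"
proof
  assume nc: "unlinked d"
  show "unlinked ((`) f ` d)"
    unfolding unlinked_def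
  proof (intro allI impI notI)
    fix p' q' r' s'
    assume "{p', q'} \<in> (`) f ` d" "{r', s'} \<in> (`) f ` d"
    then obtain p q r s where pq: "{p, q} \<in> d" "p' = f p" "q' = f q"
      and rs: "{r, s} \<in> d" "r' = f r" "s' = f s"
      by (metis image_pairE[OF _ d])
    assume "place p' < place r'" "place r' < place q'" "place q' < place s'"
    note less = this[unfolded pq rs]
    have S: "p \<in> S" "q \<in> S" "r \<in> S" "s \<in> S"
      using pairing_in[OF d] pq(1) rs(1) by blast+
    have ne: "r \<noteq> m" "q \<noteq> m" "s \<noteq> m"
      using less min[OF S(1)] min[OF S(3)] min[OF S(2)] by (metis less_asym less_trans)+
    have order: "place r < place q" "place q < place s"
      using less S ne mono by blast+
    show False
    proof (cases "p = m")
      case True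
      then have "place s < place p" using max S ne by blast
      then show False
        using unlinkedD[OF nc rs(1), of q p] pq(1) order by (simp add: insert_commute)
    next
      case False
      then have "place p < place r" using mono S ne less by blast
      then show False
        using unlinkedD[OF nc pq(1) rs(1)] order by blast
    qed
  qed
next
  assume nc: "unlinked ((`) f ` d)"
  show "unlinked d"
    unfolding unlinked_def
  proof (intro allI impI notI)
    fix p q r s
    assume pq: "{p, q} \<in> d" and rs: "{r, s} \<in> d"
      and less: "place p < place r" "place r < place q" "place q < place s"
    have S: "p \<in> S" "q \<in> S" "r \<in> S" "s \<in> S"
      using pairing_in[OF d] pq rs by blast+
    have ne: "p \<noteq> m" "r \<noteq> m" "q \<noteq> m"
      using less max[OF S(3)] max[OF S(2)] max[OF S(4)] by (metis less_asym less_trans)+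
    have order: "place (f p) < place (f r)" "place (f r) < place (f q)"
      using less S ne mono by blast+
    have pq': "{f p, f q} \<in> (`) f ` d" and rs': "{f r, f s} \<in> (`) f ` d"
      using imageI[OF pq, of "(`) f"] imageI[OF rs, of "(`) f"] by simp_all
    show False
    proof (cases "s = m")
      case True
      then have "place (f s) < place (f p)" using min S ne by blast
      then show False
        using unlinkedD[OF nc, of "f s" "f r" "f p" "f q"] pq' rs' order
        by (simp add: insert_commute)
    next
      case False
      then have "place (f q) < place (f s)" using mono S ne less by blast
      then show False
        using unlinkedD[OF nc pq' rs'] order by blast
    qed
  qed
qed

section \<open>Alternating pairs cannot be drawn\<close>

text \<open>
  These are polar coordinates with radius \<open>exp x\<close> and angle \<open>pi * y\<close>, up to scale the complex
  exponential function.  The strip \<open>0 \<le> y \<le> 1\<close> becomes the upper half-plane without the origin; the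
  southern edge goes to the positive half-axis and the northern edge, reversed, to the negative one.
\<close>

definition fold_strip :: "real ^ 2 \<Rightarrow> real ^ 2" where
  "fold_strip z = vector [exp (z $ 1) * cos (pi * z $ 2), exp (z $ 1) * sin (pi * z $ 2)]"

lemma fold_strip_nth [simp]:
  "fold_strip z $ 1 = exp (z $ 1) * cos (pi * z $ 2)"
  "fold_strip z $ 2 = exp (z $ 1) * sin (pi * z $ 2)"
  by (simp_all add: fold_strip_def)

lemma continuous_on_vector_2 :
  fixes f g :: "'a::topological_space \<Rightarrow> real"
  assumes "continuous_on S f" "continuous_on S g"
  shows "continuous_on S (\<lambda>x. vector [f x, g x] :: real ^ 2)"
proof -
  have eq: "(\<lambda>x. vector [f x, g x] :: real ^ 2) = (\<lambda>x. \<chi> i. if i = 1 then f x else g x)"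
    by (auto simp: fun_eq_iff vec_eq_iff forall_2)
  have "continuous_on S (\<lambda>x. if i = 1 then f x else g x)" for i :: 2
    using assms by (cases "i = 1") auto
  then show ?thesis
    unfolding eq by (rule continuous_on_vec_lambda)
qed

lemma continuous_on_fold_strip: "continuous_on S fold_strip"
  unfolding fold_strip_def by (intro continuous_on_vector_2 continuous_intros)

lemma inj_on_fold_strip: "inj_on fold_strip {z. 0 \<le> z $ 2 \<and> z $ 2 \<le> 1}"
proof (rule inj_onI)
  fix z w :: "real ^ 2"
  assume z: "z \<in> {z. 0 \<le> z $ 2 \<and> z $ 2 \<le> 1}" and w: "w \<in> {z. 0 \<le> z $ 2 \<and> z $ 2 \<le> 1}"
    and eq: "fold_strip z = fold_strip w"
  have c: "exp (z $ 1) * cos (pi * z $ 2) = exp (w $ 1) * cos (pi * w $ 2)"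
    using arg_cong[OF eq, of "\<lambda>v. v $ 1"] by simp
  have s: "exp (z $ 1) * sin (pi * z $ 2) = exp (w $ 1) * sin (pi * w $ 2)"
    using arg_cong[OF eq, of "\<lambda>v. v $ 2"] by simp
  have polar: "(exp a * cos t)\<^sup>2 + (exp a * sin t)\<^sup>2 = (exp a)\<^sup>2" for a t :: real
    by (simp add: power_mult_distrib flip: distrib_left)
  have "(exp (z $ 1))\<^sup>2 = (exp (w $ 1) * cos (pi * w $ 2))\<^sup>2 + (exp (w $ 1) * sin (pi * w $ 2))\<^sup>2"
    by (simp only: polar[of "z $ 1" "pi * z $ 2", symmetric] c s)
  also have "\<dots> = (exp (w $ 1))\<^sup>2"
    by (rule polar)
  finally have x: "z $ 1 = w $ 1"
    by simp
  have cos_eq: "cos (pi * z $ 2) = cos (pi * w $ 2)"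
    using c unfolding x by simp
  have "pi * z $ 2 = pi * w $ 2"
    by (rule cos_inj_pi[OF _ _ _ _ cos_eq]) (use z w in \<open>simp_all add: mult_le_cancel_left1\<close>)
  with x show "z = w"
    by (simp add: vec_eq_iff forall_2)
qed

lemma fold_strip_position:
  "fold_strip (position p) $ 2 = 0"
  "place p < place q \<Longrightarrow> fold_strip (position p) $ 1 < fold_strip (position q) $ 1"
proof -
  show "fold_strip (position p) $ 2 = 0"
    by (cases p) auto
  have *: "- exp (1 + real i) < exp (1 + real j)" for i j
    by (rule less_trans[of _ 0]) auto
  show "place p < place q \<Longrightarrow> fold_strip (position p) $ 1 < fold_strip (position q) $ 1"
    using * by (cases p; cases q) (auto simp: add.commute)
qed

lemma rectangle_eq:
  "rectangle m n = {z. 0 \<le> z $ 1 \<and> z $ 1 \<le> real (max m n) + 1 \<and> 0 \<le> z $ 2 \<and> z $ 2 \<le> 1}"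
  by (auto simp: rectangle_def mem_box_cart forall_2)

lemma interior_rectangle:
  "interior (rectangle m n) =
     {z. 0 < z $ 1 \<and> z $ 1 < real (max m n) + 1 \<and> 0 < z $ 2 \<and> z $ 2 < 1}"
  by (auto simp: rectangle_def mem_box_cart forall_2)

lemma in_points [simp]: "North i \<in> points m n \<longleftrightarrow> i < m" "South j \<in> points m n \<longleftrightarrow> j < n"
  by (auto simp: points_def)

lemma position_in_rectangle: "p \<in> points m n \<Longrightarrow> position p \<in> rectangle m n"
  by (auto simp: points_def rectangle_eq)

lemma fold_strip_rectangle:
  assumes "z \<in> rectangle m n"
  defines "M \<equiv> exp (real (max m n) + 1)"
  shows "fold_strip z \<in> cbox (vector [- M, 0]) (vector [M, M])"
proof -
  have e: "exp (z $ 1) \<le> M"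
    using assms by (simp add: rectangle_eq)
  have "0 \<le> sin (pi * z $ 2)"
    using assms(1) by (intro sin_ge_zero) (auto simp: rectangle_eq mult_le_cancel_left1)
  then have "0 \<le> exp (z $ 1) * sin (pi * z $ 2)" by simp
  moreover have "\<bar>exp (z $ 1) * c\<bar> \<le> M" if "\<bar>c\<bar> \<le> 1" for c
    using mult_mono[OF e that] by (simp add: abs_mult M_def)
  from this[OF abs_cos_le_one] this[OF abs_sin_le_one]
  have "\<bar>exp (z $ 1) * cos (pi * z $ 2)\<bar> \<le> M" "\<bar>exp (z $ 1) * sin (pi * z $ 2)\<bar> \<le> M"
    by auto
  ultimately show ?thesis
    by (auto simp: mem_box_cart forall_2 abs_le_iff)
qed

text \<open>
  A drawing leaves the direction of its lines open; the intersection theorem needs a fixed one.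
\<close>

lemma path_from_to:
  assumes "path g" "{pathstart g, pathfinish g} = {a, b}"
  obtains f where "path f" "path_image f = path_image g" "pathstart f = a" "pathfinish f = b"
proof -
  consider "pathstart g = a" "pathfinish g = b" | "pathstart g = b" "pathfinish g = a"
    using assms(2) by (auto simp: doubleton_eq_iff)
  then show thesis
  proof cases
    case 1
    then show thesis using that[of g] assms(1) by auto
  next
    case 2
    then show thesis using that[of "reversepath g"] assms(1) by auto
  qed
qed

text \<open>
  After folding, two lines with alternating ends run in a box whose lower edge contains all four
  ends, and there they must meet.  As folding is injective on the rectangle, the original
  lines meet as well, which contradicts the disjointness of the lines in a drawing.
\<close>

lemma drawing_imp_unlinked:
  assumes d: "pairing (points m n) d" and dr: "drawing m n d \<gamma>"
  shows "unlinked d"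
  unfolding unlinked_def
proof (intro allI impI notI)
  fix p q r s
  assume pq: "{p, q} \<in> d" and rs: "{r, s} \<in> d"
    and less: "place p < place r" "place r < place q" "place q < place s"
  have line: "\<exists>f. path f \<and> path_image f = path_image (\<gamma> {a, b}) \<and> pathstart f = position a
      \<and> pathfinish f = position b \<and> path_image f \<subseteq> rectangle m n" if ab: "{a, b} \<in> d" for a b
  proof -
    have ends: "arc (\<gamma> {a, b})" "{pathstart (\<gamma> {a, b}), pathfinish (\<gamma> {a, b})} = {position a, position b}"
      and inside: "path_image (\<gamma> {a, b}) - {position a, position b} \<subseteq> interior (rectangle m n)"
      using dr ab by (auto simp: drawing_def)
    obtain f where f: "path f" "path_image f = path_image (\<gamma> {a, b})"
      "pathstart f = position a" "pathfinish f = position b"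
      by (rule path_from_to[OF arc_imp_path[OF ends(1)] ends(2)])
    have "{a, b} \<subseteq> points m n"
      using d ab by (auto simp: pairing_def partition_on_def)
    then have "path_image f \<subseteq> rectangle m n"
      using inside f(2) interior_subset[of "rectangle m n"] position_in_rectangle by blast
    with f show ?thesis by blast
  qed
  obtain f where f: "path f" "path_image f = path_image (\<gamma> {p, q})" "pathstart f = position p"
    "pathfinish f = position q" "path_image f \<subseteq> rectangle m n"
    using line[OF pq] by blast
  obtain g where g: "path g" "path_image g = path_image (\<gamma> {r, s})" "pathstart g = position r"
    "pathfinish g = position s" "path_image g \<subseteq> rectangle m n"
    using line[OF rs] by blast
  define M where "M = exp (real (max m n) + 1)"
  have box: "path_image (fold_strip \<circ> h) \<subseteq> cbox (vector [- M, 0]) (vector [M, M])"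
    if "path_image h \<subseteq> rectangle m n" for h
    unfolding path_image_compose M_def
    using fold_strip_rectangle that by (intro image_subsetI) blast
  have paths: "path (fold_strip \<circ> f)" "path (fold_strip \<circ> g)"
    using f(1) g(1) by (auto intro: path_continuous_image continuous_on_fold_strip)
  obtain w where w: "w \<in> path_image (fold_strip \<circ> f)" "w \<in> path_image (fold_strip \<circ> g)"
    by (rule fashoda_interlace[OF paths box[OF f(5)] box[OF g(5)]])
      (simp_all only: pathstart_compose pathfinish_compose f(3,4) g(3,4) fold_strip_position less vector_2)
  then obtain y z where y: "y \<in> path_image f" and z: "z \<in> path_image g"
    and eq: "fold_strip y = fold_strip z"
    by (auto simp: path_image_compose simp del: fold_strip_nth)
  have "y = z"
    using inj_onD[OF inj_on_fold_strip eq] y z f(5) g(5) by (auto simp: rectangle_eq)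
  then have "path_image (\<gamma> {p, q}) \<inter> path_image (\<gamma> {r, s}) \<noteq> {}"
    using y z f(2) g(2) by auto
  moreover have "{p, q} \<noteq> {r, s}"
    using less by (auto simp: doubleton_eq_iff)
  ultimately show False
    using dr pq rs by (auto simp: drawing_def disjoint_family_on_def)
qed

section \<open>Drawing pairs that do not alternate\<close>

text \<open>
  The factor \<open>1 - position p $ 2 - position q $ 2\<close> is \<open>- 1\<close> for two northern points, \<open>1\<close> for two
  southern points and \<open>0\<close> otherwise.  So one formula gives parabolas hanging from the northern edge,
  parabolas standing on the southern edge, and straight propagating lines.  All parabolas have the
  same leading coefficient, up to sign; this keeps nested ones disjoint.
\<close>

definition sag :: "real \<Rightarrow> point \<Rightarrow> point \<Rightarrow> real" where
  "sag K p q = (1 - position p $ 2 - position q $ 2) *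
     ((position q $ 1 - position p $ 1)\<^sup>2 / (2 * K\<^sup>2))"

definition line :: "real \<Rightarrow> point \<Rightarrow> point \<Rightarrow> real \<Rightarrow> real ^ 2" where
  "line K p q = (\<lambda>t. vector
     [(1 - t) * position p $ 1 + t * position q $ 1,
      (1 - t) * position p $ 2 + t * position q $ 2 + sag K p q * (t * (1 - t))])"

lemma line_nth [simp]:
  "line K p q t $ 1 = (1 - t) * position p $ 1 + t * position q $ 1"
  "line K p q t $ 2 = (1 - t) * position p $ 2 + t * position q $ 2 + sag K p q * (t * (1 - t))"
  by (simp_all add: line_def)

lemma position_eq_iff [simp]: "position p = position q \<longleftrightarrow> p = q"
  by (cases p; cases q) (auto simp: vec_eq_iff forall_2)

lemma line_endpoints: "pathstart (line K p q) = position p" "pathfinish (line K p q) = position q"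
  by (auto simp: pathstart_def pathfinish_def vec_eq_iff forall_2)

lemma arc_line:
  assumes "p \<noteq> q"
  shows "arc (line K p q)"
  unfolding arc_def
proof
  show "path (line K p q)"
    unfolding path_def line_def by (intro continuous_on_vector_2 continuous_intros)
  show "inj_on (line K p q) {0..1}"
  proof (rule inj_onI)
    fix t u :: real
    assume eq: "line K p q t = line K p q u"
    have 1: "(t - u) * (position q $ 1 - position p $ 1) = 0"
      using arg_cong[OF eq, of "\<lambda>v. v $ 1"] by (simp add: algebra_simps)
    \<comment> \<open>If the ends lie above each other, the line is vertical and its second coordinate decides.\<close>
    show "t = u"
    proof (cases "position q $ 1 = position p $ 1")
      case True
      then have "position q $ 2 \<noteq> position p $ 2"
        using assms position_eq_iff[of p q] by (auto simp: vec_eq_iff forall_2 simp del: position_eq_iff)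
      moreover have "(t - u) * (position q $ 2 - position p $ 2) = 0"
        using arg_cong[OF eq, of "\<lambda>v. v $ 2"] True by (simp add: sag_def algebra_simps)
      ultimately show ?thesis by simp
    next
      case False
      with 1 show ?thesis by simp
    qed
  qed
qed

text \<open>
  The depth of a parabola whose ends have distance \<open>d\<close>; the bounds keep it inside the rectangle.
\<close>

lemma bump_bounds:
  fixes d t K :: real
  assumes "0 < t" "t < 1" "d \<noteq> 0" "\<bar>d\<bar> \<le> K"
  shows "0 < d\<^sup>2 / (2 * K\<^sup>2) * (t * (1 - t))" "d\<^sup>2 / (2 * K\<^sup>2) * (t * (1 - t)) < 1 / 2"
proof -
  have K: "0 < K" using assms by linarith
  have d: "0 < d\<^sup>2" "d\<^sup>2 \<le> K\<^sup>2"
    using assms power_mono[of "\<bar>d\<bar>" K 2] by auto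
  have t: "0 < t * (1 - t)" using assms by simp
  have "t * (1 - t) < 1 * 1"
    by (rule mult_strict_mono) (use assms in auto)
  then have "d\<^sup>2 * (t * (1 - t)) < K\<^sup>2 * 1"
    using d t by (intro mult_le_less_imp_less) auto
  then show "d\<^sup>2 / (2 * K\<^sup>2) * (t * (1 - t)) < 1 / 2"
    using K by (simp add: divide_simps)
  show "0 < d\<^sup>2 / (2 * K\<^sup>2) * (t * (1 - t))"
    using d t K by simp
qed

lemma position_1_bounds:
  assumes "p \<in> points m n"
  shows "1 \<le> position p $ 1" "position p $ 1 \<le> real (max m n)"
  using assms by (auto simp: points_def)

lemma line_interior:
  assumes pq: "p \<in> points m n" "q \<in> points m n" "p \<noteq> q" and t: "0 < t" "t < 1"
    and K: "K = real (max m n)"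
  shows "line K p q t \<in> interior (rectangle m n)"
proof -
  have x: "1 \<le> position p $ 1" "position p $ 1 \<le> K" "1 \<le> position q $ 1" "position q $ 1 \<le> K"
    using position_1_bounds[OF pq(1)] position_1_bounds[OF pq(2)] K by auto
  have lower: "(1 - t) * 1 + t * 1 \<le> line K p q t $ 1"
    unfolding line_nth by (intro add_mono mult_left_mono) (use t x in auto)
  have upper: "line K p q t $ 1 \<le> (1 - t) * K + t * K"
    unfolding line_nth by (intro add_mono mult_left_mono) (use t x in auto)
  have "(1 - t) * K + t * K = K" by (simp add: algebra_simps)
  then have "line K p q t $ 1 < real (max m n) + 1"
    using upper K by linarith
  moreover have "0 < line K p q t $ 1"
    using lower by (simp del: line_nth)
  ultimately have 1: "0 < line K p q t $ 1" "line K p q t $ 1 < real (max m n) + 1"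
    by simp_all
  have d: "\<bar>position q $ 1 - position p $ 1\<bar> \<le> K"
    using x by linarith
  note b = bump_bounds[OF t _ d]
  have 2: "0 < line K p q t $ 2 \<and> line K p q t $ 2 < 1"
  proof (cases "position q $ 2 = position p $ 2")
    case True
    then have "position q $ 1 - position p $ 1 \<noteq> 0"
      using pq(3) by (cases p; cases q) auto
    note b = b[OF this]
    consider "position p $ 2 = 0" | "position p $ 2 = 1"
      by (cases p) auto
    then show ?thesis
      using b True by cases (auto simp: sag_def)
  next
    case False
    then show ?thesis
      using t by (cases p; cases q) (auto simp: sag_def)
  qed
  show ?thesis
    using 1 2 by (auto simp: interior_rectangle simp del: line_nth)
qed

text \<open>
  In the coordinate \<open>x\<close>, which is shifted so that \<open>North i\<close> lies over \<open>i\<close>, a parabola has depth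
  \<open>(x - a) * (b - x) / (2 * K\<^sup>2)\<close> at \<open>x\<close>, where \<open>a\<close> and \<open>b\<close> are the numbers of its ends.
\<close>

lemma mem_cap:
  assumes "z \<in> path_image (line K (North b) (North a))" and "a < b"
  defines "x \<equiv> z $ 1 - 1"
  shows "real a \<le> x" "x \<le> real b" "1 - z $ 2 = (x - a) * (b - x) / (2 * K\<^sup>2)"
proof -
  obtain t where t: "0 \<le> t" "t \<le> 1" and z: "z = line K (North b) (North a) t"
    using assms by (auto simp: path_image_def)
  have l: "x - a = (1 - t) * (real b - real a)" and r: "b - x = t * (real b - real a)"
    by (simp_all add: x_def z algebra_simps)
  have "0 \<le> x - a" "0 \<le> b - x"
    unfolding l r using t \<open>a < b\<close> by simp_all
  then show "real a \<le> x" "x \<le> real b" by simp_all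
  have "(x - a) * (b - x) = (real b - real a)\<^sup>2 * (t * (1 - t))"
    by (simp add: l r power2_eq_square)
  then show "1 - z $ 2 = (x - a) * (b - x) / (2 * K\<^sup>2)"
    by (simp add: z sag_def power2_commute[of "real a" "real b"])
qed

lemma mem_cup:
  assumes "z \<in> path_image (line K (South a) (South b))" and "a < b"
  defines "x \<equiv> z $ 1 - 1"
  shows "real a \<le> x" "x \<le> real b" "z $ 2 = (x - a) * (b - x) / (2 * K\<^sup>2)"
proof -
  obtain t where t: "0 \<le> t" "t \<le> 1" and z: "z = line K (South a) (South b) t"
    using assms by (auto simp: path_image_def)
  have l: "x - a = t * (real b - real a)" and r: "b - x = (1 - t) * (real b - real a)"
    by (simp_all add: x_def z algebra_simps)
  have "0 \<le> x - a" "0 \<le> b - x"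
    unfolding l r using t \<open>a < b\<close> by simp_all
  then show "real a \<le> x" "x \<le> real b" by simp_all
  have "(x - a) * (b - x) = (real b - real a)\<^sup>2 * (t * (1 - t))"
    by (simp add: l r power2_eq_square)
  then show "z $ 2 = (x - a) * (b - x) / (2 * K\<^sup>2)"
    by (simp add: z sag_def)
qed

lemma mem_propagating_line:
  assumes "z \<in> path_image (line K (North i) (South j))"
  shows "0 \<le> z $ 2" "z $ 2 \<le> 1" "z $ 1 - 1 = z $ 2 * i + (1 - z $ 2) * j"
  using assms by (auto simp: path_image_def sag_def algebra_simps)

lemma caps_disjoint:
  fixes a b a' b' x :: real
  assumes "a \<le> x" "x \<le> b" "a' \<le> x" "x \<le> b'"
    and nested: "a < a' \<and> b' < b \<or> a' < a \<and> b < b'"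
  shows "(x - a) * (b - x) \<noteq> (x - a') * (b' - x)"
proof -
  have *: "(x - a') * (b' - x) < (x - a) * (b - x)"
    if "a < a'" "b' < b" "a' \<le> x" "x \<le> b'" for a b a' b' :: real
    using that by (intro mult_strict_mono) auto
  show ?thesis
    using nested *[of a a' b' b] *[of a' a b b'] assms by auto
qed

text \<open>
  A propagating line moves sideways by at most \<open>K\<close> while it descends by \<open>1\<close>, so at depth \<open>t\<close> it has moved
  by at most \<open>t * K\<close>.  The parabola is so flat that its points at depth \<open>t\<close> are at distance at least
  \<open>2 * t * K\<close> from both of its ends.  So a line that starts outside cannot reach it.
\<close>

lemma cap_propagating_disjoint:
  fixes a b i j x t K :: real
  assumes x: "a \<le> x" "x \<le> b" and t: "t = (x - a) * (b - x) / (2 * K\<^sup>2)"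
    and line: "x = (1 - t) * i + t * j"
    and K: "b - a < K" "\<bar>j - i\<bar> \<le> K" and outside: "i < a \<or> b < i"
  shows False
proof -
  have K0: "0 < K" using x K by linarith
  have "0 \<le> t" using x by (simp add: t)
  then have "t * \<bar>j - i\<bar> \<le> t * K"
    using K by (intro mult_left_mono) auto
  then have dist: "\<bar>x - i\<bar> \<le> t * K"
  proof -
    have "x - i = t * (j - i)" by (simp add: line algebra_simps)
    then show ?thesis using \<open>t * \<bar>j - i\<bar> \<le> t * K\<close> \<open>0 \<le> t\<close> by (simp add: abs_mult)
  qed
  have tK: "t * K = (x - a) * (b - x) / (2 * K)"
    using K0 by (simp add: t power2_eq_square)
  have "(x - a) * (b - x) \<le> (x - a) * K" "(x - a) * (b - x) \<le> K * (b - x)"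
    using x K by (auto intro!: mult_left_mono mult_right_mono)
  then have "t * K \<le> (x - a) / 2" "t * K \<le> (b - x) / 2"
    unfolding tK using K0 by (simp_all add: divide_simps mult.commute)
  moreover from outside have "x - a < \<bar>x - i\<bar> \<or> b - x < \<bar>x - i\<bar>"
    by auto
  ultimately show False
    using dist x by auto
qed

text \<open>
  Parabolas on opposite edges stay in opposite halves of the rectangle.
\<close>

lemma cap_cup_disjoint:
  fixes a b a' b' x K :: real
  assumes "a \<le> x" "x \<le> b" "b - a < K" "a' \<le> x" "x \<le> b'" "b' - a' < K"
  shows "(x - a) * (b - x) / (2 * K\<^sup>2) + (x - a') * (b' - x) / (2 * K\<^sup>2) \<noteq> 1"
proof -
  have K0: "0 < K" using assms by linarith
  have *: "(x - a) * (b - x) / (2 * K\<^sup>2) < 1 / 2" if "a \<le> x" "x \<le> b" "b - a < K" for a b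
  proof -
    have "(x - a) * (b - x) < K * K"
      using that by (intro mult_strict_mono) auto
    then show ?thesis using K0 by (simp add: divide_simps power2_eq_square)
  qed
  show ?thesis
    using *[of a b] *[of a' b'] assms by linarith
qed

lemma propagating_disjoint:
  fixes i j i' j' y :: real
  assumes "0 \<le> y" "y \<le> 1" "i < i'" "j < j'"
  shows "y * i + (1 - y) * j < y * i' + (1 - y) * j'"
proof (cases "y = 0")
  case False
  then have "y * i < y * i'" "(1 - y) * j \<le> (1 - y) * j'"
    using assms by (auto intro: mult_left_mono)
  then show ?thesis by linarith
qed (use assms in simp)

text \<open>
  The case distinction is over the edges on which the four ends lie; in every case that the boundary
  order admits, one of the preceding estimates applies.
\<close>

lemma lines_disjoint:
  assumes P: "{p, q, r, s} \<subseteq> points m n" and K: "K = real (max m n)"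
    and less: "place p < place q" "place r < place s" "place p < place r"
    and distinct: "q \<noteq> r" "q \<noteq> s"
    and nc: "\<not> (place r < place q \<and> place q < place s)"
  shows "path_image (line K p q) \<inter> path_image (line K r s) = {}"
proof (rule ccontr)
  assume "path_image (line K p q) \<inter> path_image (line K r s) \<noteq> {}"
  then obtain z where z: "z \<in> path_image (line K p q)" "z \<in> path_image (line K r s)"
    by blast
  define x where "x = z $ 1 - 1"
  \<comment> \<open>Parabolas need a bound on the distance of their ends, propagating lines one on their
    sideways movement.\<close>
  have K': "real (b - a) < K" "\<bar>real a - real b\<bar> \<le> K"
    if "North b \<in> points m n \<or> South b \<in> points m n" "North a \<in> points m n \<or> South a \<in> points m n"
    for a b
    using that by (auto simp: points_def K)
  show False
  proof (cases q)
    case q: (North q')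
    then obtain p' where p: "p = North p'" and pq: "q' < p'"
      using less by (cases p) auto
    note c = mem_cap[OF z(1)[unfolded p q] pq, folded x_def]
    show False
    proof (cases s)
      case s: (North s')
      then obtain r' where r: "r = North r'" and rs: "s' < r'"
        using less by (cases r) auto
      note c' = mem_cap[OF z(2)[unfolded r s] rs, folded x_def]
      have "r' < p'" "r' < q' \<or> q' < s'"
        using less nc distinct by (auto simp: p q r s)
      moreover have "(x - q') * (p' - x) = (x - s') * (r' - x)"
        using c(3) c'(3) K'[of p' q'] P p q by auto
      ultimately show False
        using caps_disjoint[of q' x p' s' r'] c c' by auto
    next
      case s: (South s')
      show False
      proof (cases r)
        case r: (North r')
        note l = mem_propagating_line[OF z(2)[unfolded r s], folded x_def]
        have "r' < q' \<or> p' < r'"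
          using less nc distinct by (auto simp: p q r s)
        then show False
          using cap_propagating_disjoint[OF c, of r' s'] l(3) K'[of p' q'] K'[of r' s'] P p q r s pq
          by (auto simp: of_nat_diff)
      next
        case r: (South r')
        have rs: "r' < s'" using less by (auto simp: r s)
        note c' = mem_cup[OF z(2)[unfolded r s] rs, folded x_def]
        show False
          using cap_cup_disjoint[OF c(1,2) _ c'(1,2), of K] c(3) c'(3) K'[of p' q'] K'[of s' r'] P p q r s pq rs
          by (auto simp: of_nat_diff)
      qed
    qed
  next
    case q: (South q')
    show False
    proof (cases p)
      case p: (North p')
      note l = mem_propagating_line[OF z(1)[unfolded p q], folded x_def]
      show False
      proof (cases s)
        case s: (North s')
        then obtain r' where r: "r = North r'" and rs: "s' < r'"
          using less by (cases r) auto
        note c' = mem_cap[OF z(2)[unfolded r s] rs, folded x_def]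
        show False
          using cap_propagating_disjoint[OF c', of p' q'] l(3) K'[of r' s'] K'[of p' q'] P p q r s rs less
          by (auto simp: of_nat_diff)
      next
        case s: (South s')
        show False
        proof (cases r)
          case r: (North r')
          note l' = mem_propagating_line[OF z(2)[unfolded r s], folded x_def]
          have "r' < p'" "s' < q'"
            using less nc distinct by (auto simp: p q r s)
          then show False
            using propagating_disjoint[OF l(1,2), of r' p' s' q'] l(3) l'(3) by auto
        next
          case r: (South r')
          have rs: "r' < s'" using less by (auto simp: r s)
          note c' = mem_cup[OF z(2)[unfolded r s] rs, folded x_def]
          have "q' < r' \<or> s' < q'"
            using less nc distinct by (auto simp: p q r s)
          then show False
            using cap_propagating_disjoint[OF c', of q' p'] l(3) K'[of s' r'] K'[of q' p'] P p q r s rs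
            by (auto simp: of_nat_diff algebra_simps)
        qed
      qed
    next
      case p: (South p')
      have pq: "p' < q'" using less by (auto simp: p q)
      obtain r' where r: "r = South r'"
        using less p by (cases r) auto
      then obtain s' where s: "s = South s'" and rs: "r' < s'"
        using less by (cases s) auto
      note c = mem_cup[OF z(1)[unfolded p q] pq, folded x_def]
      note c' = mem_cup[OF z(2)[unfolded r s] rs, folded x_def]
      have "p' < r'" "q' < r' \<or> s' < q'"
        using less nc distinct by (auto simp: p q r s)
      moreover have "(x - p') * (q' - x) = (x - r') * (s' - x)"
        using c(3) c'(3) K'[of q' p'] P p q by auto
      ultimately show False
        using caps_disjoint[of p' x q' r' s'] c c' by auto
    qed
  qed
qed

lemma unlinked_imp_drawing:
  assumes d: "pairing (points m n) d" and nc: "unlinked d"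
  shows "\<exists>\<gamma>. drawing m n d \<gamma>"
proof -
  define K where "K = real (max m n)"
  have "\<forall>B\<in>d. \<exists>g p q. B = {p, q} \<and> place p < place q \<and> g = line K p q"
  proof
    fix B assume "B \<in> d"
    then obtain p q where "B = {p, q}" "p \<noteq> q"
      by (rule pairing_blockE[OF d])
    moreover from this have "place p < place q \<or> place q < place p"
      using linorder_less_linear[of "place p" "place q"] by auto
    ultimately show "\<exists>g p q. B = {p, q} \<and> place p < place q \<and> g = line K p q"
      by (auto simp: doubleton_eq_iff)
  qed
  from bchoice[OF this]
  obtain \<gamma> where \<gamma>: "\<forall>B\<in>d. \<exists>p q. B = {p, q} \<and> place p < place q \<and> \<gamma> B = line K p q" ..
  have "drawing m n d \<gamma>"
    unfolding drawing_def disjoint_family_on_def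
  proof (intro conjI ballI impI)
    fix B assume B: "B \<in> d"
    obtain p q where pq: "B = {p, q}" "place p < place q" "\<gamma> B = line K p q"
      using bspec[OF \<gamma> B] by blast
    have neq: "p \<noteq> q" using pq by auto
    have P: "p \<in> points m n" "q \<in> points m n"
      using d B pq by (auto simp: pairing_def partition_on_def)
    show "arc (\<gamma> B)" using pq neq by (simp add: arc_line)
    show "{pathstart (\<gamma> B), pathfinish (\<gamma> B)} = position ` B"
      using pq by (simp add: line_endpoints)
    show "path_image (\<gamma> B) - position ` B \<subseteq> interior (rectangle m n)"
    proof
      fix z assume z: "z \<in> path_image (\<gamma> B) - position ` B"
      then obtain t where t: "0 \<le> t" "t \<le> 1" "z = line K p q t"
        by (auto simp: pq(3) path_image_def)
      moreover have "t \<noteq> 0" "t \<noteq> 1"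
        using z t line_endpoints[of K p q] by (auto simp: pq(1) pathstart_def pathfinish_def)
      ultimately show "z \<in> interior (rectangle m n)"
        using line_interior[OF P neq _ _ K_def] by auto
    qed
  next
    fix B C assume B: "B \<in> d" and C: "C \<in> d" and neq: "B \<noteq> C"
    obtain p q where pq: "B = {p, q}" "place p < place q" "\<gamma> B = line K p q"
      using bspec[OF \<gamma> B] by blast
    obtain r s where rs: "C = {r, s}" "place r < place s" "\<gamma> C = line K r s"
      using bspec[OF \<gamma> C] by blast
    have P: "{p, q, r, s} \<subseteq> points m n"
      using d B C pq rs by (auto simp: pairing_def partition_on_def)
    have "B \<inter> C = {}"
      using d B C neq by (auto simp: pairing_def partition_on_def disjoint_def)
    then have ne: "p \<noteq> r" "p \<noteq> s" "q \<noteq> r" "q \<noteq> s"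
      using pq rs by auto
    have nc1: "\<not> (place r < place q \<and> place q < place s)" if "place p < place r"
      using unlinkedD[OF nc, of p q r s] B C pq(1) rs(1) that by simp
    have nc2: "\<not> (place p < place s \<and> place s < place q)" if "place r < place p"
      using unlinkedD[OF nc, of r s p q] B C pq(1) rs(1) that by simp
    show "path_image (\<gamma> B) \<inter> path_image (\<gamma> C) = {}"
    proof (cases "place p < place r")
      case True
      then show ?thesis
        using lines_disjoint[OF P K_def pq(2) rs(2) _ ne(3,4) nc1] pq rs by simp
    next
      case False
      then have "place r < place p"
        using ne linorder_less_linear[of "place p" "place r"] by auto
      moreover have "{r, s, p, q} \<subseteq> points m n" using P by auto
      ultimately show ?thesis
        using lines_disjoint[OF _ K_def rs(2) pq(2) _ ne(2)[symmetric] ne(4)[symmetric] nc2] pq rs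
        by (simp add: Int_commute)
    qed
  qed
  then show ?thesis by blast
qed

text \<open>
  This turns all further questions about drawings into questions about the order of places.
\<close>

lemma diagrams_iff: "d \<in> diagrams m n \<longleftrightarrow> pairing (points m n) d \<and> unlinked d"
  using drawing_imp_unlinked unlinked_imp_drawing
  by (auto simp: diagrams_def pairing_def non_crossing_def)

section \<open>Propagating lines\<close>

definition north_ends :: "point set set \<Rightarrow> nat set" where
  "north_ends d = {i. \<exists>j. {North i, South j} \<in> d}"

definition south_ends :: "point set set \<Rightarrow> nat set" where
  "south_ends d = {j. \<exists>i. {North i, South j} \<in> d}"

text \<open>
  Each propagating line has one end on either edge.
\<close>

lemma card_propagating:
  assumes d: "pairing S d"
  shows "card {B \<in> d. propagating B} = card (north_ends d)"
    and "card {B \<in> d. propagating B} = card (south_ends d)"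
proof -
  have "disjoint d" using d by (simp add: pairing_def partition_on_def)
  then have same: "B = C" if "B \<in> d" "C \<in> d" "p \<in> B" "p \<in> C" for B C p
    using that disjointD by blast
  have "bij_betw (\<lambda>B. THE i. North i \<in> B) {B \<in> d. propagating B} (north_ends d)"
  proof (rule bij_betw_imageI)
    show "inj_on (\<lambda>B. THE i. North i \<in> B) {B \<in> d. propagating B}"
    proof (rule inj_onI)
      fix B C assume B: "B \<in> {B \<in> d. propagating B}" and C: "C \<in> {B \<in> d. propagating B}"
        and eq: "(THE i. North i \<in> B) = (THE i. North i \<in> C)"
      obtain i j i' j' where "B = {North i, South j}" "C = {North i', South j'}"
        using B C by (auto simp: propagating_def)
      with eq have "North i \<in> B" "North i \<in> C" by auto
      with same[of B C] B C show "B = C" by blast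
    qed
    show "(\<lambda>B. THE i. North i \<in> B) ` {B \<in> d. propagating B} = north_ends d"
      unfolding north_ends_def
    proof (intro set_eqI iffI)
      fix x assume "x \<in> (\<lambda>B. THE i. North i \<in> B) ` {B \<in> d. propagating B}"
      then obtain a b where "{North a, South b} \<in> d" "x = (THE i. North i \<in> {North a, South b})"
        by (auto simp: propagating_def)
      then show "x \<in> {i. \<exists>j. {North i, South j} \<in> d}" by auto
    next
      fix i assume "i \<in> {i. \<exists>j. {North i, South j} \<in> d}"
      then obtain j where "{North i, South j} \<in> d" by auto
      then show "i \<in> (\<lambda>B. THE i. North i \<in> B) ` {B \<in> d. propagating B}"
        by (intro image_eqI[of _ _ "{North i, South j}"]) (auto simp: propagating_def)
    qed
  qed
  then show "card {B \<in> d. propagating B} = card (north_ends d)"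
    by (rule bij_betw_same_card)
  have "bij_betw (\<lambda>B. THE j. South j \<in> B) {B \<in> d. propagating B} (south_ends d)"
  proof (rule bij_betw_imageI)
    show "inj_on (\<lambda>B. THE j. South j \<in> B) {B \<in> d. propagating B}"
    proof (rule inj_onI)
      fix B C assume B: "B \<in> {B \<in> d. propagating B}" and C: "C \<in> {B \<in> d. propagating B}"
        and eq: "(THE j. South j \<in> B) = (THE j. South j \<in> C)"
      obtain i j i' j' where "B = {North i, South j}" "C = {North i', South j'}"
        using B C by (auto simp: propagating_def)
      with eq have "South j \<in> B" "South j \<in> C" by auto
      with same[of B C] B C show "B = C" by blast
    qed
    show "(\<lambda>B. THE j. South j \<in> B) ` {B \<in> d. propagating B} = south_ends d"
      unfolding south_ends_def
    proof (intro set_eqI iffI)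
      fix x assume "x \<in> (\<lambda>B. THE j. South j \<in> B) ` {B \<in> d. propagating B}"
      then obtain a b where "{North a, South b} \<in> d" "x = (THE j. South j \<in> {North a, South b})"
        by (auto simp: propagating_def)
      then show "x \<in> {j. \<exists>i. {North i, South j} \<in> d}" by auto
    next
      fix j assume "j \<in> {j. \<exists>i. {North i, South j} \<in> d}"
      then obtain i where "{North i, South j} \<in> d" by auto
      then show "j \<in> (\<lambda>B. THE j. South j \<in> B) ` {B \<in> d. propagating B}"
        by (intro image_eqI[of _ _ "{North i, South j}"]) (auto simp: propagating_def)
    qed
  qed
  then show "card {B \<in> d. propagating B} = card (south_ends d)"
    by (rule bij_betw_same_card)
qed

text \<open>
  There are \<open>l\<close> southern points and every propagating line uses one of them, so there are \<open>l\<close>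
  propagating lines exactly if no southern point is left for another kind of pair.
\<close>

lemma upper_diagrams_iff:
  "d \<in> diagrams_prop l n l \<longleftrightarrow>
     pairing (points n l) d \<and> unlinked d \<and> (\<forall>j k. {South j, South k} \<notin> d)"
proof (cases "pairing (points n l) d")
  case True
  have sub: "south_ends d \<subseteq> {..<l}"
  proof
    fix j assume "j \<in> south_ends d"
    then obtain i where "{North i, South j} \<in> d" by (auto simp: south_ends_def)
    from pairing_in(2)[OF True this] show "j \<in> {..<l}" by simp
  qed
  have "card (south_ends d) = card {..<l} \<longleftrightarrow> south_ends d = {..<l}"
    using card_subset_eq[OF finite_lessThan sub] by (intro iffI) simp_all
  then have card: "card {B \<in> d. propagating B} = l \<longleftrightarrow> south_ends d = {..<l}"
    by (simp add: card_propagating(2)[OF True])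
  have none: "south_ends d = {..<l} \<longleftrightarrow> (\<forall>j k. {South j, South k} \<notin> d)"
  proof
    assume all: "south_ends d = {..<l}"
    show "\<forall>j k. {South j, South k} \<notin> d"
    proof (intro allI notI)
      fix j k assume jk: "{South j, South k} \<in> d"
      then have "j \<in> south_ends d"
        using pairing_in(1)[OF True jk] all by simp
      then obtain i where "{North i, South j} \<in> d"
        unfolding south_ends_def by blast
      then have "{South j, North i} \<in> d"
        by (simp add: insert_commute)
      from pairing_blocks_meet[OF True jk this] show False by simp
    qed
  next
    assume none: "\<forall>j k. {South j, South k} \<notin> d"
    have "j \<in> south_ends d" if "j < l" for j
    proof -
      obtain q where q: "{South j, q} \<in> d"
        using pairing_partner[OF True, of "South j"] \<open>j < l\<close> by auto
      with none obtain i where "q = North i" by (cases q) auto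
      with q have "{North i, South j} \<in> d"
        by (simp add: insert_commute)
      then show ?thesis
        unfolding south_ends_def by blast
    qed
    with sub show "south_ends d = {..<l}" by auto
  qed
  show ?thesis
    by (simp only: diagrams_prop_def diagrams_iff True mem_Collect_eq simp_thms card none)
next
  case False
  then show ?thesis by (simp add: diagrams_prop_def diagrams_iff)
qed

lemma upper_diagram_strand:
  assumes "d \<in> diagrams_prop l n l" "j < l"
  obtains i where "{North i, South j} \<in> d"
proof -
  have d: "pairing (points n l) d" and none: "\<forall>j k. {South j, South k} \<notin> d"
    using assms(1) by (auto simp: upper_diagrams_iff)
  obtain q where q: "{South j, q} \<in> d"
    using pairing_partner[OF d, of "South j"] assms(2) by auto
  with none obtain i where "q = North i" by (cases q) auto
  with q that show thesis by (auto simp: insert_commute)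
qed

section \<open>The edge maps\<close>

definition bend :: "nat \<Rightarrow> nat \<Rightarrow> point \<Rightarrow> point" where
  "bend n l p = (if p = South l then North n else p)"

definition unbend :: "nat \<Rightarrow> nat \<Rightarrow> point \<Rightarrow> point" where
  "unbend n l p = (if p = North n then South l else p)"

lemma phi_u_bend: "phi_u n (Suc l) d = (`) (bend n l) ` d"
  by (simp only: phi_u_def diff_Suc_1 bend_def[abs_def])

lemma unbend_bend: "p \<in> points n (Suc l) \<Longrightarrow> unbend n l (bend n l p) = p"
  by (auto simp: bend_def unbend_def)

lemma bend_unbend: "p \<in> points (Suc n) l \<Longrightarrow> bend n l (unbend n l p) = p"
  by (auto simp: bend_def unbend_def)

lemma bend_points: "bend n l ` points n (Suc l) = points (Suc n) l"
proof -
  have "bend n l p \<in> points (Suc n) l" if "p \<in> points n (Suc l)" for p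
    using that by (cases p) (auto simp: bend_def)
  moreover have "unbend n l p \<in> points n (Suc l)" if "p \<in> points (Suc n) l" for p
    using that by (cases p) (auto simp: unbend_def)
  ultimately show ?thesis
    using bend_unbend by (auto intro!: image_eqI[of _ "bend n l" "unbend n l _"])
qed

lemma unbend_points: "unbend n l ` points (Suc n) l = points n (Suc l)"
  unfolding bend_points[symmetric] image_image using unbend_bend by simp

lemma inj_on_bend: "inj_on (bend n l) (points n (Suc l))"
  by (rule inj_on_inverseI[of _ "unbend n l"]) (rule unbend_bend)

lemma inj_on_unbend: "inj_on (unbend n l) (points (Suc n) l)"
  by (rule inj_on_inverseI[of _ "bend n l"]) (rule bend_unbend)

text \<open>
  Bending moves the point at the largest place to the smallest place.
\<close>

lemma unlinked_bend:
  assumes d: "pairing (points n (Suc l)) d"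
  shows "unlinked (phi_u n (Suc l) d) \<longleftrightarrow> unlinked d"
  unfolding phi_u_bend
proof (rule unlinked_rotate[OF d])
  show "South l \<in> points n (Suc l)" by simp
next
  fix p assume "p \<in> points n (Suc l)" "p \<noteq> South l"
  then show "place p < place (South l)" "place (bend n l (South l)) < place (bend n l p)"
    by (cases p; simp add: bend_def)+
qed (simp add: bend_def)

lemma pairing_bend:
  assumes "pairing (points n (Suc l)) d"
  shows "pairing (points (Suc n) l) (phi_u n (Suc l) d)"
  using pairing_image[OF assms inj_on_bend] by (simp add: phi_u_bend bend_points)

lemma inj_on_phi_u: "inj_on (phi_u n (Suc l)) {d. pairing (points n (Suc l)) d}"
  by (rule inj_on_inverseI[of _ "\<lambda>d. (`) (unbend n l) ` d"])
    (simp add: phi_u_bend pairing_image_id unbend_bend del: image_image)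

text \<open>
  Given a diagram whose last northern point is paired with a northern point, bending
  that last point back to the south gives a preimage.
\<close>

lemma phi_u_image:
  "phi_u n (Suc l) ` Y_TL n (Suc l) = {e \<in> Y_TL (Suc n) l. \<forall>j. {North n, South j} \<notin> e}"
proof (intro equalityI subsetI)
  fix e assume "e \<in> phi_u n (Suc l) ` Y_TL n (Suc l)"
  then obtain d where d: "pairing (points n (Suc l)) d" "unlinked d"
    and none: "\<forall>j k. {South j, South k} \<notin> d" and e: "e = phi_u n (Suc l) d"
    by (auto simp: Y_TL_def upper_diagrams_iff)
  have preimage: "\<exists>p q. {p, q} \<in> d \<and> p' = bend n l p \<and> q' = bend n l q" if "{p', q'} \<in> e" for p' q'
    using image_pairE[OF that[unfolded e phi_u_bend] d(1)] by blast
  have "{South j, South k} \<notin> e" for j k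
    using preimage[of "South j" "South k"] none by (auto simp: bend_def split: if_splits)
  moreover have "{North n, South j} \<notin> e" for j
  proof
    assume "{North n, South j} \<in> e"
    then obtain p q where pq: "{p, q} \<in> d" "North n = bend n l p" "South j = bend n l q"
      using preimage by blast
    have "p \<noteq> North n"
      using pairing_in(1)[OF d(1) pq(1)] by auto
    with pq(2,3) have "p = South l" "q = South j"
      by (simp_all add: bend_def split: if_splits)
    with pq(1) none show False by blast
  qed
  moreover have "pairing (points (Suc n) l) e" "unlinked e"
    using pairing_bend[OF d(1)] unlinked_bend[OF d(1)] d(2) by (simp_all add: e)
  ultimately show "e \<in> {e \<in> Y_TL (Suc n) l. \<forall>j. {North n, South j} \<notin> e}"
    by (simp add: Y_TL_def upper_diagrams_iff)
next
  fix e assume "e \<in> {e \<in> Y_TL (Suc n) l. \<forall>j. {North n, South j} \<notin> e}"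
  then have e: "pairing (points (Suc n) l) e" "unlinked e"
    and none: "\<forall>j k. {South j, South k} \<notin> e" and last: "\<forall>j. {North n, South j} \<notin> e"
    by (auto simp: Y_TL_def upper_diagrams_iff)
  define d where "d = (`) (unbend n l) ` e"
  have d: "pairing (points n (Suc l)) d"
    using pairing_image[OF e(1) inj_on_unbend] by (simp add: d_def unbend_points)
  have fd: "phi_u n (Suc l) d = e"
    unfolding phi_u_bend d_def by (rule pairing_image_id[OF e(1)]) (rule bend_unbend)
  have "{South j, South k} \<notin> d" for j k
  proof
    assume "{South j, South k} \<in> d"
    then obtain p q where pq: "{p, q} \<in> e" "South j = unbend n l p" "South k = unbend n l q"
      unfolding d_def by (rule image_pairE[OF _ e(1)])
    then have "p = North n \<or> p = South j" "q = North n \<or> q = South k"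
      by (simp_all add: unbend_def split: if_splits)
    then show False
      using pq(1) none last pairing_in(3)[OF e(1) pq(1)] by (auto simp: insert_commute)
  qed
  then have "d \<in> Y_TL n (Suc l)"
    using d e(2) unlinked_bend[OF d] fd by (simp add: Y_TL_def upper_diagrams_iff)
  then show "e \<in> phi_u n (Suc l) ` Y_TL n (Suc l)"
    using fd by blast
qed

text \<open>
  The new line joins the points at the two extreme places, so it alternates with no other pair
  and can be added or removed freely.
\<close>

lemma phi_one_image:
  "phi_one n l ` Y_TL n l = {e \<in> Y_TL (Suc n) (Suc l). {North n, South l} \<in> e}"
proof (intro equalityI subsetI)
  fix e assume "e \<in> phi_one n l ` Y_TL n l"
  then obtain d where d: "pairing (points n l) d" "unlinked d"
    and none: "\<forall>j k. {South j, South k} \<notin> d" and e: "e = insert {North n, South l} d"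
    by (auto simp: Y_TL_def upper_diagrams_iff phi_one_def)
  have "insert (North n) (insert (South l) (points n l)) = points (Suc n) (Suc l)"
    by (auto simp: points_def)
  then have pe: "pairing (points (Suc n) (Suc l)) e"
    using pairing_insert[OF d(1), of "North n" "South l"] by (simp add: e)
  \<comment> \<open>If the ends of two pairs alternate, one pair lacks the smallest and the other the largest
    point, but the new pair has both.\<close>
  have extreme: "place (North n) \<le> place p" "place p \<le> place (South l)"
    if "p \<in> points (Suc n) (Suc l)" for p
    using that by (cases p; simp)+
  have "unlinked e"
    unfolding unlinked_def
  proof (intro allI impI notI)
    fix p q r s
    assume pq: "{p, q} \<in> e" and rs: "{r, s} \<in> e"
      and less: "place p < place r" "place r < place q" "place q < place s"
    note P = pairing_in(1,2)[OF pe pq] pairing_in(1,2)[OF pe rs]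
    have "{p, q} \<noteq> {North n, South l}" "{r, s} \<noteq> {North n, South l}"
      using less extreme(1)[OF P(1)] extreme(2)[OF P(4)]
      by (auto simp: doubleton_eq_iff simp del: place.simps)
    then have "{p, q} \<in> d" "{r, s} \<in> d"
      using pq rs by (auto simp: e)
    then show False
      using unlinkedD[OF d(2)] less by blast
  qed
  then show "e \<in> {e \<in> Y_TL (Suc n) (Suc l). {North n, South l} \<in> e}"
    using pe none by (auto simp: Y_TL_def upper_diagrams_iff e doubleton_eq_iff)
next
  fix e assume "e \<in> {e \<in> Y_TL (Suc n) (Suc l). {North n, South l} \<in> e}"
  then have e: "pairing (points (Suc n) (Suc l)) e" "unlinked e"
    and none: "\<forall>j k. {South j, South k} \<notin> e" and last: "{North n, South l} \<in> e"
    by (auto simp: Y_TL_def upper_diagrams_iff)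
  have "points (Suc n) (Suc l) - {North n, South l} = points n l"
    by (auto simp: points_def)
  then have "pairing (points n l) (e - {{North n, South l}})"
    using pairing_delete[OF e(1) last] by simp
  then have "e - {{North n, South l}} \<in> Y_TL n l"
    using unlinked_subset[OF e(2)] none by (auto simp: Y_TL_def upper_diagrams_iff)
  moreover have "phi_one n l (e - {{North n, South l}}) = e"
    using last by (auto simp: phi_one_def)
  ultimately show "e \<in> phi_one n l ` Y_TL n l"
    by (metis imageI)
qed

lemma inj_on_phi_one: "inj_on (phi_one n l) (Y_TL n l)"
proof (rule inj_onI)
  fix d e assume d: "d \<in> Y_TL n l" and e: "e \<in> Y_TL n l" and eq: "phi_one n l d = phi_one n l e"
  have "{North n, South l} \<notin> c" if "c \<in> Y_TL n l" for c
    using that pairing_in(1)[of "points n l" c "North n" "South l"]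
    by (auto simp: Y_TL_def upper_diagrams_iff)
  with d e eq show "d = e"
    unfolding phi_one_def by (metis insert_ident)
qed

text \<open>
  A southern point further east would be joined to a northern point further west, across the line
  that ends in \<open>North n\<close>.
\<close>

lemma last_strand:
  assumes e: "e \<in> Y_TL (Suc n) l" and last: "{North n, South j} \<in> e"
  shows "l = Suc j"
proof (rule ccontr)
  assume "l \<noteq> Suc j"
  have p: "pairing (points (Suc n) l) e" and nc: "unlinked e"
    using e by (auto simp: Y_TL_def upper_diagrams_iff)
  have "j < l" using pairing_in(2)[OF p last] by simp
  with \<open>l \<noteq> Suc j\<close> have "Suc j < l" by simp
  then obtain i where i: "{North i, South (Suc j)} \<in> e"
    using upper_diagram_strand[OF e[unfolded Y_TL_def]] by blast
  then have "i < Suc n" using pairing_in(1)[OF p i] by simp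
  moreover have "i \<noteq> n"
    using pairing_blocks_meet[OF p last, of "South (Suc j)"] i by auto
  ultimately show False
    using unlinkedD[OF nc last i] by simp
qed

section \<open>The Pascal array of upper halves\<close>

lemma wf_digraph_A_inf: "wf_digraph A_inf"
  by unfold_locales (auto simp: A_inf_def)

lemma in_arcs_A_inf:
  "in_arcs A_inf 0 = {(1, 0)}" "in_arcs A_inf (Suc v) = {(Suc (Suc v), Suc v), (v, Suc v)}"
  by (auto simp: in_arcs_def A_inf_def)

lemma bidirected_A_inf: "bidirected_digraph A_inf (\<lambda>e. if e \<in> arcs A_inf then prod.swap e else e)"
  by (rule wf_digraph.bidirected_digraphI[OF wf_digraph_A_inf]) (auto simp: A_inf_def)

text \<open>
  The two arcs into a vertex correspond to the two kinds of partners that the last northern point can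
  have.  At the vertex \<open>0\<close> there are no southern points, hence only the second kind occurs.
\<close>

lemma pascal_array_Y_TL: "pascal_array A_inf 0 Y_TL edge_map_TL"
  unfolding pascal_array_def
proof (intro conjI allI ballI impI)
  show "wf_digraph A_inf" by (rule wf_digraph_A_inf)
  show "0 \<in> verts A_inf" by (simp add: A_inf_def)
  have 0: "points 0 0 = {}" by (simp add: points_def)
  have "Y_TL 0 0 = {{}}"
    by (auto simp: Y_TL_def upper_diagrams_iff 0 pairing_def partition_on_empty unlinked_def)
  then show "is_singleton (Y_TL 0 0)" by simp
  show "Y_TL 0 v = {}" if v: "v \<noteq> 0" for v
  proof (rule equals0I)
    fix d assume d: "d \<in> Y_TL 0 v"
    obtain i where "{North i, South 0} \<in> d"
      by (rule upper_diagram_strand[OF d[unfolded Y_TL_def]]) (use v in simp)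
    then show False
      using d pairing_in(1)[of "points 0 v" d "North i" "South 0"]
      by (auto simp: Y_TL_def upper_diagrams_iff)
  qed
next
  fix n e assume "e \<in> arcs A_inf"
  then consider v where "e = (Suc v, v)" | v where "e = (v, Suc v)"
    by (auto simp: A_inf_def)
  then have "edge_map_TL e n ` Y_TL n (tail A_inf e) \<subseteq> Y_TL (Suc n) (head A_inf e) \<and>
    inj_on (edge_map_TL e n) (Y_TL n (tail A_inf e))"
  proof cases
    case (1 v)
    have "inj_on (phi_u n (Suc v)) (Y_TL n (Suc v))"
      by (rule inj_on_subset[OF inj_on_phi_u]) (auto simp: Y_TL_def upper_diagrams_iff)
    with 1 show ?thesis
      using phi_u_image[of n v] by (auto simp: A_inf_def edge_map_TL_def)
  next
    case (2 v)
    then show ?thesis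
      using phi_one_image[of n v] inj_on_phi_one[of n v] by (auto simp: A_inf_def edge_map_TL_def)
  qed
  then show "edge_map_TL e n \<in> Y_TL n (tail A_inf e) \<rightarrow> Y_TL (Suc n) (head A_inf e)"
    "inj_on (edge_map_TL e n) (Y_TL n (tail A_inf e))"
    by auto
next
  fix n v
  have 1: "edge_map_TL (Suc w, w) n ` Y_TL n (tail A_inf (Suc w, w)) =
      {e \<in> Y_TL (Suc n) w. \<forall>j. {North n, South j} \<notin> e}" for w
    using phi_u_image[of n w] by (simp add: A_inf_def edge_map_TL_def)
  have 2: "edge_map_TL (w, Suc w) n ` Y_TL n (tail A_inf (w, Suc w)) =
      {e \<in> Y_TL (Suc n) (Suc w). {North n, South w} \<in> e}" for w
    using phi_one_image[of n w] by (simp add: A_inf_def edge_map_TL_def)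
  show "Y_TL (Suc n) v = (\<Union>e\<in>in_arcs A_inf v. edge_map_TL e n ` Y_TL n (tail A_inf e))"
  proof (cases v)
    case 0
    have "{North n, South j} \<notin> e" if "e \<in> Y_TL (Suc n) 0" for e j
      using last_strand[OF that] by auto
    then show ?thesis
      using 1[of 0] by (auto simp: 0 in_arcs_A_inf)
  next
    case (Suc w)
    have "{North n, South j} \<notin> e" if "e \<in> Y_TL (Suc n) (Suc w)" "{North n, South w} \<notin> e" for e j
      using last_strand[OF that(1)] that(2) by auto
    then show ?thesis
      unfolding Suc in_arcs_A_inf using 1[of "Suc w"] 2[of w] by auto
  qed
  show "disjoint_family_on (\<lambda>e. edge_map_TL e n ` Y_TL n (tail A_inf e)) (in_arcs A_inf v)"
  proof (cases v)
    case 0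
    then show ?thesis by (simp add: in_arcs_A_inf disjoint_family_on_def)
  next
    case (Suc w)
    show ?thesis
      unfolding Suc in_arcs_A_inf disjoint_family_on_def using 1[of "Suc w"] 2[of w] by auto
  qed
qed

section \<open>Turning diagrams upside down\<close>

fun flip :: "point \<Rightarrow> point" where
  "flip (North i) = South i"
| "flip (South i) = North i"

lemma flip_flip [simp]: "flip (flip p) = p"
  by (cases p) auto

lemma place_flip [simp]: "place (flip p) = - place p - 1"
  by (cases p) auto

lemma inj_flip: "inj flip"
  by (metis flip_flip injI)

abbreviation flips :: "point set set \<Rightarrow> point set set" where
  "flips \<equiv> (`) ((`) flip)"

lemma flips_flips [simp]: "flips (flips d) = d"
  by (simp add: image_image)

lemma inj_flips: "inj flips"
  by (metis flips_flips injI)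

lemma pair_in_flips [simp]: "{p, q} \<in> flips d \<longleftrightarrow> {flip p, flip q} \<in> d"
proof
  assume "{p, q} \<in> flips d"
  then obtain B where B: "B \<in> d" "{p, q} = flip ` B" by auto
  have "B = flip ` flip ` B" by (simp add: image_image)
  also have "\<dots> = {flip p, flip q}" by (simp flip: B(2))
  finally show "{flip p, flip q} \<in> d" using B(1) by simp
next
  assume "{flip p, flip q} \<in> d"
  then have "flip ` {flip p, flip q} \<in> flips d" by (rule imageI)
  then show "{p, q} \<in> flips d" by simp
qed

lemma flip_points: "flip ` points m n = points n m"
  by (auto simp: points_def image_Un image_image)

lemma flips_diagrams: "flips d \<in> diagrams n m" if "d \<in> diagrams m n"
proof -
  have "pairing (points n m) (flips d)"
    using that pairing_image[of "points m n" d flip] inj_flip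
    by (auto simp: diagrams_iff flip_points inj_on_subset)
  moreover have "unlinked (flips d)"
    unfolding unlinked_def
  proof (intro allI impI notI)
    fix p q r s
    assume "{p, q} \<in> flips d" "{r, s} \<in> flips d"
      "place p < place r" "place r < place q" "place q < place s"
    moreover have "unlinked d" using that by (simp add: diagrams_iff)
    ultimately show False
      using unlinkedD[of d "flip s" "flip r" "flip q" "flip p"] by (simp add: insert_commute)
  qed
  ultimately show ?thesis by (simp add: diagrams_iff)
qed

lemma ends_flips: "north_ends (flips d) = south_ends d"
  by (simp add: north_ends_def south_ends_def insert_commute)

lemma flips_diagrams_prop: "flips d \<in> diagrams_prop l n m" if d: "d \<in> diagrams_prop l m n"
proof -
  have "d \<in> diagrams m n" "card (south_ends d) = l"
    using d card_propagating(2) by (auto simp: diagrams_prop_def diagrams_iff)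
  moreover from this(1) have "flips d \<in> diagrams n m"
    by (rule flips_diagrams)
  moreover from this have "pairing (points n m) (flips d)"
    by (simp add: diagrams_iff)
  ultimately show ?thesis
    using card_propagating(1)[of "points n m" "flips d"] by (simp add: diagrams_prop_def ends_flips)
qed

lemma flips_image_diagrams_prop: "flips ` diagrams_prop l m n = diagrams_prop l n m"
proof (intro equalityI subsetI)
  fix d assume "d \<in> diagrams_prop l n m"
  then have "flips (flips d) \<in> flips ` diagrams_prop l m n"
    by (intro imageI flips_diagrams_prop)
  then show "d \<in> flips ` diagrams_prop l m n" by simp
qed (auto intro: flips_diagrams_prop)

text \<open>
  The characterisation of the upper halves, turned upside down.
\<close>

lemma lower_diagrams_iff:
  "d \<in> diagrams_prop l l n \<longleftrightarrow>
     pairing (points l n) d \<and> unlinked d \<and> (\<forall>i k. {North i, North k} \<notin> d)"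
proof -
  have "d \<in> diagrams_prop l l n \<longleftrightarrow> flips d \<in> diagrams_prop l n l"
    using flips_diagrams_prop[of d l l n] flips_diagrams_prop[of "flips d" l n l] by auto
  also have "\<dots> \<longleftrightarrow> flips d \<in> diagrams n l \<and> (\<forall>j k. {South j, South k} \<notin> flips d)"
    by (simp only: upper_diagrams_iff diagrams_iff conj_assoc)
  also have "flips d \<in> diagrams n l \<longleftrightarrow> d \<in> diagrams l n"
    using flips_diagrams[of d l n] flips_diagrams[of "flips d" n l] by auto
  finally show ?thesis
    by (simp only: diagrams_iff conj_assoc pair_in_flips flip.simps)
qed

lemma pascal_array_inj_image:
  assumes Y: "pascal_array G v0 Y \<phi>" and g: "inj g"
  shows "pascal_array G v0 (\<lambda>n v. g ` Y n v) (\<lambda>e n. g \<circ> \<phi> e n \<circ> inv g)"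
proof -
  have im: "(g \<circ> \<phi> e n \<circ> inv g) ` g ` Y n v = g ` \<phi> e n ` Y n v" for e n v
    using g by (simp add: image_image)
  have inj: "inj_on (g \<circ> \<phi> e n \<circ> inv g) (g ` Y n v)" if "inj_on (\<phi> e n) (Y n v)" for e n v
    using that g by (auto simp: inj_on_def)
  have "is_singleton (g ` Y 0 v0)"
    using Y by (auto simp: pascal_array_def elim!: is_singletonE)
  moreover have "g ` Y 0 v = {}" if "v \<in> verts G" "v \<noteq> v0" for v
    using Y that by (auto simp: pascal_array_def)
  moreover have "g \<circ> \<phi> e n \<circ> inv g \<in> g ` Y n (tail G e) \<rightarrow> g ` Y (Suc n) (head G e) \<and>
      inj_on (g \<circ> \<phi> e n \<circ> inv g) (g ` Y n (tail G e))" if "e \<in> arcs G" for e n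
  proof -
    have "\<phi> e n \<in> Y n (tail G e) \<rightarrow> Y (Suc n) (head G e)" "inj_on (\<phi> e n) (Y n (tail G e))"
      using Y that by (simp_all add: pascal_array_def)
    then show ?thesis
      using inj g by (auto simp: Pi_iff)
  qed
  moreover have "g ` Y (Suc n) v = (\<Union>e\<in>in_arcs G v. (g \<circ> \<phi> e n \<circ> inv g) ` g ` Y n (tail G e)) \<and>
      disjoint_family_on (\<lambda>e. (g \<circ> \<phi> e n \<circ> inv g) ` g ` Y n (tail G e)) (in_arcs G v)"
    if "v \<in> verts G" for n v
  proof
    have Yv: "Y (Suc n) v = (\<Union>e\<in>in_arcs G v. \<phi> e n ` Y n (tail G e))"
      and disj: "disjoint_family_on (\<lambda>e. \<phi> e n ` Y n (tail G e)) (in_arcs G v)"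
      using Y that by (auto simp: pascal_array_def)
    show "g ` Y (Suc n) v = (\<Union>e\<in>in_arcs G v. (g \<circ> \<phi> e n \<circ> inv g) ` g ` Y n (tail G e))"
      unfolding im Yv by (rule image_UN)
    show "disjoint_family_on (\<lambda>e. (g \<circ> \<phi> e n \<circ> inv g) ` g ` Y n (tail G e)) (in_arcs G v)"
      using disj unfolding im disjoint_family_on_def
      by (metis g image_Int image_empty)
  qed
  ultimately show ?thesis
    using Y by (simp add: pascal_array_def)
qed

lemma pascal_array_lower_halves:
  "pascal_array A_inf 0 (\<lambda>n l. diagrams_prop l l n) (\<lambda>e n. flips \<circ> edge_map_TL e n \<circ> inv flips)"
  using pascal_array_inj_image[OF pascal_array_Y_TL inj_flips]
  by (simp add: Y_TL_def flips_image_diagrams_prop)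

section \<open>Cutting and gluing\<close>

lemma cut_point_eq: "cut_point d i = card {i' \<in> north_ends d. i' < i}"
  unfolding cut_point_def north_ends_def by (rule arg_cong[of _ _ card]) auto

text \<open>
  The cut point of a propagating line is the rank of its northern end among all such ends; this and
  the next lemma are the general facts on ranks.
\<close>

lemma rank_less:
  fixes A :: "nat set"
  assumes "finite A" "i \<in> A" "i < k"
  shows "card {j \<in> A. j < i} < card {j \<in> A. j < k}"
  by (rule psubset_card_mono) (use assms in auto)

lemma bij_betw_rank:
  fixes A :: "nat set"
  assumes A: "finite A"
  shows "bij_betw (\<lambda>i. card {j \<in> A. j < i}) A {..<card A}"
proof (rule bij_betw_imageI)
  show inj: "inj_on (\<lambda>i. card {j \<in> A. j < i}) A"
  proof (rule inj_onI)
    fix i k assume "i \<in> A" "k \<in> A" "card {j \<in> A. j < i} = card {j \<in> A. j < k}"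
    then show "i = k"
      using rank_less[OF A, of i k] rank_less[OF A, of k i] by (cases i k rule: linorder_cases) auto
  qed
  have "card {j \<in> A. j < i} < card A" if "i \<in> A" for i
    by (rule psubset_card_mono[OF A]) (use that in auto)
  then show "(\<lambda>i. card {j \<in> A. j < i}) ` A = {..<card A}"
    using inj by (intro card_subset_eq) (auto simp: card_image)
qed

lemma north_ends_less:
  assumes "pairing (points m n) d" "i \<in> north_ends d"
  shows "i < m"
proof -
  obtain j where "{North i, South j} \<in> d"
    using assms(2) by (auto simp: north_ends_def)
  from pairing_in(1)[OF assms(1) this] show ?thesis by simp
qed

lemma cut_point_bij:
  assumes d: "pairing (points m n) d" and l: "l = card {B \<in> d. propagating B}"
  shows "bij_betw (cut_point d) (north_ends d) {..<l}"
    and "\<And>i k. i \<in> north_ends d \<Longrightarrow> i < k \<Longrightarrow> cut_point d i < cut_point d k"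
proof -
  have "north_ends d \<subseteq> {..<m}"
    using north_ends_less[OF d] by auto
  then have fin: "finite (north_ends d)"
    by (rule finite_subset) simp
  show "bij_betw (cut_point d) (north_ends d) {..<l}"
    using bij_betw_rank[OF fin] unfolding l card_propagating(1)[OF d] cut_point_eq[abs_def] .
  show "cut_point d i < cut_point d k" if "i \<in> north_ends d" "i < k" for i k
    unfolding cut_point_eq by (rule rank_less[OF fin that])
qed

text \<open>
  A pairing is determined by its pairs of two northern points, of two southern points and of one
  point on either edge; these equivalences record which of them occur in a half.
\<close>

lemma upper_half_pairs:
  "{North a, North b} \<in> upper_half d \<longleftrightarrow> {North a, North b} \<in> d"
  "{North i, South k} \<in> upper_half d \<longleftrightarrow> i \<in> north_ends d \<and> k = cut_point d i"
  "{South j, South k} \<notin> upper_half d"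
  by (auto simp: upper_half_def north_ends_def doubleton_eq_iff)

lemma lower_half_pairs:
  "{South a, South b} \<in> lower_half d \<longleftrightarrow> {South a, South b} \<in> d"
  "{North k, South j} \<in> lower_half d \<longleftrightarrow> (\<exists>i. {North i, South j} \<in> d \<and> k = cut_point d i)"
  "{North a, North b} \<notin> lower_half d"
  by (auto simp: lower_half_def doubleton_eq_iff)

text \<open>
  Numbering the cut points is strictly increasing in the northern ends, so the new lines do not
  alternate with each other; the other pairs are those of \<open>d\<close>.
\<close>

lemma upper_half_diagram:
  assumes d: "d \<in> diagrams m n" and l: "l = card {B \<in> d. propagating B}"
  shows "upper_half d \<in> diagrams_prop l m l"
  unfolding upper_diagrams_iff
proof (intro conjI allI)
  have p: "pairing (points m n) d" and nc: "unlinked d"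
    using d by (auto simp: diagrams_iff)
  note cp = cut_point_bij[OF p l]
  have range: "i < m" "cut_point d i < l" if "i \<in> north_ends d" for i
    using that north_ends_less[OF p] bij_betwE[OF cp(1)] by auto
  show "pairing (points m l) (upper_half d)"
  proof (rule pairingI)
    fix B assume "B \<in> upper_half d"
    then consider "B \<in> d" "B \<subseteq> range North"
      | i where "i \<in> north_ends d" "B = {North i, South (cut_point d i)}"
      by (auto simp: upper_half_def north_ends_def)
    then show "\<exists>p q. B = {p, q} \<and> p \<noteq> q \<and> p \<in> points m l \<and> q \<in> points m l"
    proof cases
      case 1
      obtain p q where pq: "B = {p, q}" "p \<noteq> q" "p \<in> points m n" "q \<in> points m n"
        by (rule pairing_blockE[OF p 1(1)])
      then obtain a b where "p = North a" "q = North b"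
        using 1(2) by auto
      then show ?thesis
        using pq by (intro exI[of _ p] exI[of _ q]) simp
    next
      case 2
      then show ?thesis
        using range by (intro exI[of _ "North i"] exI[of _ "South (cut_point d i)"]) simp
    qed
  next
    fix x assume x: "x \<in> points m l"
    show "\<exists>q. {x, q} \<in> upper_half d"
    proof (cases x)
      case (North i)
      then obtain q where q: "{North i, q} \<in> d"
        using pairing_partner[OF p, of "North i"] x by auto
      show ?thesis
      proof (cases q)
        case (North b)
        then show ?thesis using q upper_half_pairs(1) \<open>x = North i\<close> by blast
      next
        case (South j)
        then have "i \<in> north_ends d" using q by (auto simp: north_ends_def)
        then show ?thesis using upper_half_pairs(2) \<open>x = North i\<close> by blast
      qed
    next
      case (South k)
      then have "k \<in> cut_point d ` north_ends d"
        using x cp(1) by (simp add: bij_betw_def)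
      then obtain i where "{North i, South k} \<in> upper_half d"
        by (auto simp: upper_half_pairs)
      then show ?thesis
        unfolding South by (metis insert_commute)
    qed
  next
    fix x q r assume xq: "{x, q} \<in> upper_half d" and xr: "{x, r} \<in> upper_half d"
    have inj: "i = i'" if "i \<in> north_ends d" "i' \<in> north_ends d" "cut_point d i = cut_point d i'" for i i'
      using cp(1) that by (auto simp: bij_betw_def inj_on_def)
    have NS: "\<not> ({North a, North b} \<in> d \<and> a \<in> north_ends d)" for a b
      using pairing_blocks_meet[OF p, of "North a" "North b"] by (auto simp: north_ends_def)
    show "q = r"
      using xq xr inj NS pairing_blocks_meet[OF p, of x q r]
      by (cases x; cases q; cases r) (auto simp: upper_half_pairs)
  qed
  show "unlinked (upper_half d)"
  proof (rule unlinkedI)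
    fix a b c e
    assume "{North a, North b} \<in> upper_half d" "{North c, North e} \<in> upper_half d"
      and less: "a < c" "c < b" "b < e"
    then have "{North e, North c} \<in> d" "{North b, North a} \<in> d"
      by (simp_all add: upper_half_pairs insert_commute)
    from unlinkedD[OF nc this] less show False by simp
  next
    fix a b c j
    assume "{North a, North b} \<in> upper_half d" "{North c, South j} \<in> upper_half d"
      and less: "a < c" "c < b"
    then obtain j' where "{North b, North a} \<in> d" "{North c, South j'} \<in> d"
      by (auto simp: upper_half_pairs north_ends_def insert_commute)
    from unlinkedD[OF nc this] less show False by simp
  next
    fix a b j k
    assume "{North a, South j} \<in> upper_half d" "{North b, South k} \<in> upper_half d"
      and less: "a < b" "k < j"
    then show False
      using cp(2)[of a b] by (simp add: upper_half_pairs)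
  qed (simp_all add: upper_half_pairs)
  show "{South j, South k} \<notin> upper_half d" for j k
    by (rule upper_half_pairs)
qed

text \<open>
  Unlike in the upper half, the cut points replace the northern ends here, so the order of the
  southern ends is compared with the order of the northern ends of \<open>d\<close>.
\<close>

lemma lower_half_diagram:
  assumes d: "d \<in> diagrams m n" and l: "l = card {B \<in> d. propagating B}"
  shows "lower_half d \<in> diagrams_prop l l n"
  unfolding lower_diagrams_iff
proof (intro conjI allI)
  have p: "pairing (points m n) d" and nc: "unlinked d"
    using d by (auto simp: diagrams_iff)
  note cp = cut_point_bij[OF p l]
  have range: "cut_point d i < l" "j < n" if "{North i, South j} \<in> d" for i j
    using that pairing_in(2)[OF p that] bij_betwE[OF cp(1)] by (auto simp: north_ends_def)
  have inj: "i = i'" if "{North i, South j} \<in> d" "{North i', South j'} \<in> d" "cut_point d i = cut_point d i'"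
    for i i' j j'
  proof -
    have "i \<in> north_ends d" "i' \<in> north_ends d" using that by (auto simp: north_ends_def)
    with that(3) show ?thesis using cp(1) by (auto simp: bij_betw_def inj_on_def)
  qed
  show "pairing (points l n) (lower_half d)"
  proof (rule pairingI)
    fix B assume "B \<in> lower_half d"
    then consider "B \<in> d" "B \<subseteq> range South"
      | i j where "{North i, South j} \<in> d" "B = {North (cut_point d i), South j}"
      by (auto simp: lower_half_def)
    then show "\<exists>p q. B = {p, q} \<and> p \<noteq> q \<and> p \<in> points l n \<and> q \<in> points l n"
    proof cases
      case 1
      obtain p q where pq: "B = {p, q}" "p \<noteq> q" "p \<in> points m n" "q \<in> points m n"
        by (rule pairing_blockE[OF p 1(1)])
      then obtain a b where "p = South a" "q = South b"
        using 1(2) by auto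
      then show ?thesis
        using pq by (intro exI[of _ p] exI[of _ q]) simp
    next
      case 2
      then show ?thesis
        using range[of i j] by (intro exI[of _ "North (cut_point d i)"] exI[of _ "South j"]) simp
    qed
  next
    fix x assume x: "x \<in> points l n"
    show "\<exists>q. {x, q} \<in> lower_half d"
    proof (cases x)
      case (South j)
      then obtain q where q: "{South j, q} \<in> d"
        using pairing_partner[OF p, of "South j"] x by auto
      show ?thesis
      proof (cases q)
        case (South b)
        then show ?thesis using q lower_half_pairs(1) \<open>x = South j\<close> by blast
      next
        case (North i)
        then have "{North (cut_point d i), South j} \<in> lower_half d"
          using q by (auto simp: lower_half_pairs)
        then show ?thesis unfolding \<open>x = South j\<close> by (metis insert_commute)
      qed
    next
      case (North k)
      then have "k \<in> cut_point d ` north_ends d"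
        using x cp(1) by (simp add: bij_betw_def)
      then obtain i j where "{North i, South j} \<in> d" "k = cut_point d i"
        by (auto simp: north_ends_def)
      then have "{North k, South j} \<in> lower_half d"
        by (auto simp: lower_half_pairs)
      then show ?thesis
        unfolding North by blast
    qed
  next
    fix x q r assume xq: "{x, q} \<in> lower_half d" and xr: "{x, r} \<in> lower_half d"
    have meet: "y = z" if "{w, y} \<in> d" "{w, z} \<in> d" for w y z
      by (rule pairing_blocks_meet[OF p that])
    show "q = r"
    proof (cases x)
      case (North k)
      then obtain j j' where jj': "q = South j" "r = South j'"
        using xq xr by (cases q; cases r) (auto simp: lower_half_pairs)
      then obtain i i' where "{North i, South j} \<in> d" "{North i', South j'} \<in> d"
        "k = cut_point d i" "k = cut_point d i'"
        using xq xr North by (auto simp: lower_half_pairs)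
      then have "j = j'" using inj[of i j i' j'] meet[of "North i" "South j" "South j'"] by auto
      with jj' show ?thesis by simp
    next
      case (South j)
      have SN: "i = i'" if "{North i, South j} \<in> d" "{North i', South j} \<in> d" for i i'
        using meet[of "South j" "North i" "North i'"] that by simp
      have SS: "\<not> ({South j, South k} \<in> d \<and> {North i, South j} \<in> d)" for i k
        using meet[of "South j" "South k" "North i"] by auto
      show ?thesis
        using xq xr South SN SS meet[of x q r]
        by (cases q; cases r) (auto simp: lower_half_pairs)
    qed
  qed
  show "unlinked (lower_half d)"
  proof (rule unlinkedI)
    fix a b j k
    assume "{North a, South j} \<in> lower_half d" "{North b, South k} \<in> lower_half d"
      and less: "a < b" "k < j"
    then obtain i i' where i: "{North i, South j} \<in> d" "a = cut_point d i"
      and i': "{North i', South k} \<in> d" "b = cut_point d i'"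
      by (auto simp: lower_half_pairs)
    have "i' \<in> north_ends d" using i' by (auto simp: north_ends_def)
    then have "i < i'"
      using cp(2)[of i' i] less i(2) i'(2) by (cases i i' rule: linorder_cases) auto
    then show False
      using unlinkedD[OF nc i'(1) i(1)] less by simp
  next
    fix j k a c
    assume "{South j, South k} \<in> lower_half d" "{North a, South c} \<in> lower_half d"
      and less: "j < c" "c < k"
    then obtain i where "{North i, South c} \<in> d" "{South j, South k} \<in> d"
      by (auto simp: lower_half_pairs)
    from unlinkedD[OF nc this] less show False by simp
  next
    fix a b c e
    assume "{South a, South b} \<in> lower_half d" "{South c, South e} \<in> lower_half d"
      and less: "a < c" "c < b" "b < e"
    then have "{South a, South b} \<in> d" "{South c, South e} \<in> d"
      by (simp_all add: lower_half_pairs)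
    from unlinkedD[OF nc this] less show False by simp
  qed (simp_all add: lower_half_pairs)
  show "{North i, North k} \<notin> lower_half d" for i k
    by (rule lower_half_pairs)
qed

definition glue :: "point set set \<Rightarrow> point set set \<Rightarrow> point set set" where
  "glue U L =
     {B \<in> U. B \<subseteq> range North} \<union> {B \<in> L. B \<subseteq> range South} \<union>
     {{North i, South j} | i j. \<exists>k. {North i, South k} \<in> U \<and> {North k, South j} \<in> L}"

lemma glue_pairs:
  "{North a, North b} \<in> glue U L \<longleftrightarrow> {North a, North b} \<in> U"
  "{South a, South b} \<in> glue U L \<longleftrightarrow> {South a, South b} \<in> L"
  "{North i, South j} \<in> glue U L \<longleftrightarrow> (\<exists>k. {North i, South k} \<in> U \<and> {North k, South j} \<in> L)"
  by (auto simp: glue_def doubleton_eq_iff)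

text \<open>
  Distinct propagating lines have distinct cut points, so gluing joins the two
  parts of the same line.
\<close>

lemma glue_cut:
  assumes d: "d \<in> diagrams m n"
  shows "glue (upper_half d) (lower_half d) = d"
proof -
  have p: "pairing (points m n) d"
    using d by (simp add: diagrams_iff)
  have inj: "inj_on (cut_point d) (north_ends d)"
    using cut_point_bij(1)[OF p refl] by (simp add: bij_betw_def)
  have NS: "{North i, South j} \<in> glue (upper_half d) (lower_half d) \<longleftrightarrow> {North i, South j} \<in> d" for i j
  proof -
    have "i = i'" if "i \<in> north_ends d" "{North i', South j} \<in> d" "cut_point d i = cut_point d i'" for i'
      using inj that by (auto simp: inj_on_def north_ends_def)
    then show ?thesis
      by (auto simp: glue_pairs upper_half_pairs lower_half_pairs north_ends_def)
  qed
  show ?thesis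
  proof (intro set_eqI iffI)
    fix B assume "B \<in> d"
    obtain x y where "B = {x, y}" by (rule pairing_blockE[OF p \<open>B \<in> d\<close>])
    with \<open>B \<in> d\<close> show "B \<in> glue (upper_half d) (lower_half d)"
      by (cases x; cases y)
        (simp_all add: NS glue_pairs(1,2) upper_half_pairs(1) lower_half_pairs(1))
  next
    fix B assume B: "B \<in> glue (upper_half d) (lower_half d)"
    then consider "B \<in> d" | i j where "B = {North i, South j}"
      unfolding glue_def by (auto simp: upper_half_def lower_half_def)
    then show "B \<in> d"
      using B NS by cases auto
  qed
qed

text \<open>
  For the opposite composition, an arbitrary upper half \<open>U\<close> is glued to an arbitrary lower half \<open>L\<close> with
  the same number \<open>l\<close> of propagating lines.
\<close>

context
  fixes l m n :: nat and U L :: "point set set"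
  assumes U: "U \<in> diagrams_prop l m l" and L: "L \<in> diagrams_prop l l n"
begin

lemma upper_facts:
  "pairing (points m l) U" "unlinked U" "{South j, South k} \<notin> U"
  using U unfolding upper_diagrams_iff by blast+

lemma lower_facts:
  "pairing (points l n) L" "unlinked L" "{North i, North k} \<notin> L"
  using L unfolding lower_diagrams_iff by blast+

lemma upper_strand: "k < l \<Longrightarrow> \<exists>i. {North i, South k} \<in> U"
  using upper_diagram_strand[OF U] by blast

lemma lower_strand:
  assumes "k < l"
  shows "\<exists>j. {North k, South j} \<in> L"
proof -
  obtain q where "{North k, q} \<in> L"
    using pairing_partner[OF lower_facts(1), of "North k"] assms by auto
  with lower_facts(3) show ?thesis by (cases q) auto
qed

lemma upper_unique:
  "{North i, South k} \<in> U \<Longrightarrow> {North i, South k'} \<in> U \<Longrightarrow> k = k'"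
  "{North i, South k} \<in> U \<Longrightarrow> {North i', South k} \<in> U \<Longrightarrow> i = i'"
  using pairing_blocks_meet[OF upper_facts(1), of "North i" "South k" "South k'"]
    pairing_blocks_meet[OF upper_facts(1), of "South k" "North i" "North i'"] by simp_all

lemma lower_unique:
  "{North k, South j} \<in> L \<Longrightarrow> {North k, South j'} \<in> L \<Longrightarrow> j = j'"
  "{North k, South j} \<in> L \<Longrightarrow> {North k', South j} \<in> L \<Longrightarrow> k = k'"
  using pairing_blocks_meet[OF lower_facts(1), of "North k" "South j" "South j'"]
    pairing_blocks_meet[OF lower_facts(1), of "South j" "North k" "North k'"] by simp_all

lemma upper_mono: "{North i, South k} \<in> U \<Longrightarrow> {North i', South k'} \<in> U \<Longrightarrow> i < i' \<Longrightarrow> k < k'"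
  using unlinkedD[OF upper_facts(2), of "North i'" "South k'" "North i" "South k"]
    upper_unique(2)[of i k i'] by (cases k k' rule: linorder_cases) auto

lemma lower_mono: "{North k, South j} \<in> L \<Longrightarrow> {North k', South j'} \<in> L \<Longrightarrow> k < k' \<Longrightarrow> j < j'"
  using unlinkedD[OF lower_facts(2), of "North k'" "South j'" "North k" "South j"]
    lower_unique(2)[of k j k'] by (cases j j' rule: linorder_cases) auto

lemma upper_range: "{North i, South k} \<in> U \<Longrightarrow> i < m \<and> k < l"
  using pairing_in(1,2)[OF upper_facts(1), of "North i" "South k"] by simp

lemma lower_range: "{North k, South j} \<in> L \<Longrightarrow> k < l \<and> j < n"
  using pairing_in(1,2)[OF lower_facts(1), of "North k" "South j"] by simp

lemma pairing_glue: "pairing (points m n) (glue U L)"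
proof (rule pairingI)
  fix B assume "B \<in> glue U L"
  then consider "B \<in> U" "B \<subseteq> range North" | "B \<in> L" "B \<subseteq> range South"
    | i j k where "{North i, South k} \<in> U" "{North k, South j} \<in> L" "B = {North i, South j}"
    by (auto simp: glue_def)
  then show "\<exists>p q. B = {p, q} \<and> p \<noteq> q \<and> p \<in> points m n \<and> q \<in> points m n"
  proof cases
    case 1
    obtain p q where pq: "B = {p, q}" "p \<noteq> q" "p \<in> points m l" "q \<in> points m l"
      by (rule pairing_blockE[OF upper_facts(1) 1(1)])
    then obtain a b where "p = North a" "q = North b"
      using 1(2) by auto
    then show ?thesis
        using pq by (intro exI[of _ p] exI[of _ q]) simp
  next
    case 2
    obtain p q where pq: "B = {p, q}" "p \<noteq> q" "p \<in> points l n" "q \<in> points l n"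
      by (rule pairing_blockE[OF lower_facts(1) 2(1)])
    then obtain a b where "p = South a" "q = South b"
      using 2(2) by auto
    then show ?thesis
        using pq by (intro exI[of _ p] exI[of _ q]) simp
  next
    case 3
    then show ?thesis
      using upper_range[OF 3(1)] lower_range[OF 3(2)]
      by (intro exI[of _ "North i"] exI[of _ "South j"]) simp
  qed
next
  fix x assume x: "x \<in> points m n"
  show "\<exists>q. {x, q} \<in> glue U L"
  proof (cases x)
    case (North i)
    then obtain q where q: "{North i, q} \<in> U"
      using pairing_partner[OF upper_facts(1), of "North i"] x by auto
    show ?thesis
    proof (cases q)
      case (North b)
      then show ?thesis using q glue_pairs(1) \<open>x = North i\<close> by blast
    next
      case (South k)
      then obtain j where "{North k, South j} \<in> L"
        using q upper_range lower_strand by blast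
      then show ?thesis using q South glue_pairs(3) \<open>x = North i\<close> by blast
    qed
  next
    case (South j)
    then obtain q where q: "{South j, q} \<in> L"
      using pairing_partner[OF lower_facts(1), of "South j"] x by auto
    show ?thesis
    proof (cases q)
      case (South b)
      then show ?thesis using q glue_pairs(2) \<open>x = South j\<close> by blast
    next
      case (North k)
      then have "{North k, South j} \<in> L" using q by simp
      then obtain i where "{North i, South j} \<in> glue U L"
        using lower_range upper_strand glue_pairs(3) by blast
      then show ?thesis unfolding \<open>x = South j\<close> by (metis insert_commute)
    qed
  qed
next
  fix x q r assume xq: "{x, q} \<in> glue U L" and xr: "{x, r} \<in> glue U L"
  have NN: "\<not> ({North a, North b} \<in> U \<and> {North a, South k} \<in> U)" for a b k
    using pairing_blocks_meet[OF upper_facts(1), of "North a" "North b" "South k"] by auto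
  have SS: "\<not> ({South a, South b} \<in> L \<and> {North k, South a} \<in> L)" for a b k
    using pairing_blocks_meet[OF lower_facts(1), of "South a" "South b" "North k"] by auto
  have same: "{x, q} \<in> U \<Longrightarrow> {x, r} \<in> U \<Longrightarrow> q = r"
    "{x, q} \<in> L \<Longrightarrow> {x, r} \<in> L \<Longrightarrow> q = r"
    by (rule pairing_blocks_meet[OF upper_facts(1)] pairing_blocks_meet[OF lower_facts(1)]; assumption)+
  show "q = r"
    using xq xr NN SS same upper_unique lower_unique
    by (cases x; cases q; cases r) (simp_all add: glue_pairs; blast)+
qed

text \<open>
  The southern ends of the glued lines are ordered like their northern ends, because both halves
  preserve the order.
\<close>

lemma unlinked_glue: "unlinked (glue U L)"
proof (rule unlinkedI)
  fix a b c e
  assume "{North a, North b} \<in> glue U L" "{North c, North e} \<in> glue U L"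
    and less: "a < c" "c < b" "b < e"
  then have "{North e, North c} \<in> U" "{North b, North a} \<in> U"
    by (simp_all add: glue_pairs insert_commute)
  from unlinkedD[OF upper_facts(2) this] less show False by simp
next
  fix a b c j
  assume "{North a, North b} \<in> glue U L" "{North c, South j} \<in> glue U L"
    and less: "a < c" "c < b"
  then obtain k where "{North b, North a} \<in> U" "{North c, South k} \<in> U"
    by (auto simp: glue_pairs insert_commute)
  from unlinkedD[OF upper_facts(2) this] less show False by simp
next
  fix a b j k
  assume "{North a, South j} \<in> glue U L" "{North b, South k} \<in> glue U L"
    and less: "a < b" "k < j"
  then obtain h h' where a: "{North a, South h} \<in> U" "{North h, South j} \<in> L"
    and b: "{North b, South h'} \<in> U" "{North h', South k} \<in> L"
    by (auto simp: glue_pairs)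
  have "h < h'" by (rule upper_mono[OF a(1) b(1) less(1)])
  from lower_mono[OF a(2) b(2) this] less(2) show False by simp
next
  fix j k a c
  assume "{South j, South k} \<in> glue U L" "{North a, South c} \<in> glue U L"
    and less: "j < c" "c < k"
  then obtain h where "{North h, South c} \<in> L" "{South j, South k} \<in> L"
    by (auto simp: glue_pairs)
  from unlinkedD[OF lower_facts(2) this] less show False by simp
next
  fix a b c e
  assume "{South a, South b} \<in> glue U L" "{South c, South e} \<in> glue U L"
    and less: "a < c" "c < b" "b < e"
  then have "{South a, South b} \<in> L" "{South c, South e} \<in> L"
    by (simp_all add: glue_pairs)
  from unlinkedD[OF lower_facts(2) this] less show False by simp
qed

lemma glue_diagram: "glue U L \<in> diagrams m n"
  using pairing_glue unlinked_glue by (simp add: diagrams_iff)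

lemma north_ends_glue: "north_ends (glue U L) = north_ends U"
  using upper_range lower_strand by (fastforce simp: north_ends_def glue_pairs)

lemma card_propagating_glue: "card {B \<in> glue U L. propagating B} = l"
  using card_propagating(1)[OF pairing_glue] card_propagating(1)[OF upper_facts(1)] U
  by (simp add: north_ends_glue diagrams_prop_def)

text \<open>
  The lines of \<open>U\<close> with a southern end smaller than \<open>k\<close> are exactly those that start
  further west than \<open>i\<close>, and there are \<open>k\<close> of them.  So cutting the glued diagram recovers the numbers
  along which the halves were glued.
\<close>

lemma cut_point_glue:
  assumes ik: "{North i, South k} \<in> U"
  shows "cut_point (glue U L) i = k"
proof -
  have "\<forall>k'\<in>{..<l}. \<exists>i. {North i, South k'} \<in> U"
    using upper_strand by simp
  from bchoice[OF this] obtain g where g: "\<forall>k'\<in>{..<l}. {North (g k'), South k'} \<in> U" ..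
  have "k < l" using upper_range[OF ik] by simp
  have "bij_betw g {..<k} {i' \<in> north_ends U. i' < i}"
  proof (rule bij_betw_imageI)
    show "inj_on g {..<k}"
    proof (rule inj_onI)
      fix a b assume "a \<in> {..<k}" "b \<in> {..<k}" "g a = g b"
      then have "{North (g b), South a} \<in> U" "{North (g b), South b} \<in> U"
        using bspec[OF g, of a] bspec[OF g, of b] \<open>k < l\<close> by auto
      then show "a = b"
        by (rule upper_unique(1))
    qed
    show "g ` {..<k} = {i' \<in> north_ends U. i' < i}"
    proof (intro equalityI subsetI)
      fix i' assume "i' \<in> g ` {..<k}"
      then obtain k' where k': "k' < k" "i' = g k'" by auto
      then have i'U: "{North i', South k'} \<in> U" using g \<open>k < l\<close> by simp
      then have "i' < i"
        using upper_mono[OF ik i'U] upper_unique(1)[of i k k'] ik k'(1)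
        by (cases i i' rule: linorder_cases) auto
      then show "i' \<in> {i' \<in> north_ends U. i' < i}"
        using i'U by (auto simp: north_ends_def)
    next
      fix i' assume "i' \<in> {i' \<in> north_ends U. i' < i}"
      then obtain k' where i': "{North i', South k'} \<in> U" "i' < i"
        by (auto simp: north_ends_def)
      have "k' < k" by (rule upper_mono[OF i'(1) ik i'(2)])
      moreover have "i' = g k'"
        using upper_unique(2)[OF i'(1), of "g k'"] g \<open>k' < k\<close> \<open>k < l\<close> by simp
      ultimately show "i' \<in> g ` {..<k}" by simp
    qed
  qed
  then show ?thesis
    using bij_betw_same_card by (fastforce simp: cut_point_eq north_ends_glue)
qed

lemma upper_half_glue: "upper_half (glue U L) = U"
proof (rule pairing_ext)
  show "pairing (points m l) (upper_half (glue U L))"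
    using upper_half_diagram[OF glue_diagram card_propagating_glue[symmetric]]
    by (simp add: upper_diagrams_iff)
  show "pairing (points m l) U" by (rule upper_facts)
  have "{North i, South k} \<in> upper_half (glue U L) \<longleftrightarrow> {North i, South k} \<in> U" for i k
    using cut_point_glue[of i] by (auto simp: upper_half_pairs north_ends_glue) (auto simp: north_ends_def)
  then show "{p, q} \<in> upper_half (glue U L) \<longleftrightarrow> {p, q} \<in> U" for p q
    using upper_facts(3) by (cases p; cases q) (simp_all add: upper_half_pairs(1,3) glue_pairs)
qed

lemma lower_half_glue: "lower_half (glue U L) = L"
proof (rule pairing_ext)
  show "pairing (points l n) (lower_half (glue U L))"
    using lower_half_diagram[OF glue_diagram card_propagating_glue[symmetric]]
    by (simp add: lower_diagrams_iff)
  show "pairing (points l n) L" by (rule lower_facts)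
  have "{North k, South j} \<in> lower_half (glue U L) \<longleftrightarrow> {North k, South j} \<in> L" for k j
  proof
    assume "{North k, South j} \<in> lower_half (glue U L)"
    then obtain i k' where "{North i, South k'} \<in> U" "{North k', South j} \<in> L" "k = cut_point (glue U L) i"
      by (auto simp: lower_half_pairs glue_pairs)
    then show "{North k, South j} \<in> L" using cut_point_glue[of i k'] by simp
  next
    assume kj: "{North k, South j} \<in> L"
    then obtain i where i: "{North i, South k} \<in> U"
      using lower_range upper_strand by blast
    then show "{North k, South j} \<in> lower_half (glue U L)"
      using kj cut_point_glue[OF i] unfolding lower_half_pairs glue_pairs by blast
  qed
  then show "{p, q} \<in> lower_half (glue U L) \<longleftrightarrow> {p, q} \<in> L" for p q
    using lower_facts(3) by (cases p; cases q) (simp_all add: lower_half_pairs(1,3) glue_pairs)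
qed

end

lemma bij_betw_cut_diagram:
  "bij_betw cut_diagram (diagrams m n) (SIGMA l:UNIV. diagrams_prop l m l \<times> diagrams_prop l l n)"
proof (rule bij_betw_byWitness[where f' = "\<lambda>(l, U, L). glue U L"])
  show "\<forall>d\<in>diagrams m n. (case cut_diagram d of (l, U, L) \<Rightarrow> glue U L) = d"
    using glue_cut by (simp add: cut_diagram_def)
  show "\<forall>t\<in>(SIGMA l:UNIV. diagrams_prop l m l \<times> diagrams_prop l l n).
      cut_diagram (case t of (l, U, L) \<Rightarrow> glue U L) = t"
    using card_propagating_glue upper_half_glue lower_half_glue by (auto simp: cut_diagram_def)
  show "cut_diagram ` diagrams m n \<subseteq> (SIGMA l:UNIV. diagrams_prop l m l \<times> diagrams_prop l l n)"
    using upper_half_diagram lower_half_diagram by (auto simp: cut_diagram_def)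
  show "(\<lambda>(l, U, L). glue U L) ` (SIGMA l:UNIV. diagrams_prop l m l \<times> diagrams_prop l l n) \<subseteq> diagrams m n"
    using glue_diagram by auto
qed

theorem proposition3p1:
  shows "pascal_array A_inf 0 Y_TL edge_map_TL \<and>
    (\<forall>n. bij_betw cut_diagram (diagrams n n)
           (SIGMA l:verts A_inf. diagrams_prop l n l \<times> diagrams_prop l l n)) \<and>
    (\<exists>\<psi>. pascal_array A_inf 0 (\<lambda>n l. diagrams_prop l l n) \<psi>) \<and>
    catalan_sequence A_inf 0 (\<lambda>n. diagrams n n) Y_TL edge_map_TL"
proof -
  have cut: "\<forall>n. bij_betw cut_diagram (diagrams n n)
      (SIGMA l:verts A_inf. diagrams_prop l n l \<times> diagrams_prop l l n)"
    using bij_betw_cut_diagram by (simp add: A_inf_def)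
  have lower: "\<exists>\<psi>. pascal_array A_inf 0 (\<lambda>n l. diagrams_prop l l n) \<psi>"
    using pascal_array_lower_halves by blast
  have "catalan_sequence A_inf 0 (\<lambda>n. diagrams n n) Y_TL edge_map_TL"
    unfolding catalan_sequence_def
  proof (intro conjI)
    show "\<exists>rev. bidirected_digraph A_inf rev"
      using bidirected_A_inf by blast
    show "pascal_array A_inf 0 Y_TL edge_map_TL" by (rule pascal_array_Y_TL)
    obtain \<psi> where \<psi>: "pascal_array A_inf 0 (\<lambda>n l. diagrams_prop l l n) \<psi>"
      using lower ..
    have "\<forall>n. \<exists>h. bij_betw h (diagrams n n) (SIGMA v:verts A_inf. Y_TL n v \<times> diagrams_prop v v n)"
      using cut unfolding Y_TL_def by blast
    with \<psi> show "\<exists>(Y' :: nat \<Rightarrow> nat \<Rightarrow> point set set set) \<phi>'. pascal_array A_inf 0 Y' \<phi>' \<and>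
        (\<forall>n. \<exists>h. bij_betw h (diagrams n n) (SIGMA v:verts A_inf. Y_TL n v \<times> Y' n v))"
      by (intro exI[of _ "\<lambda>n l. diagrams_prop l l n"] exI[of _ \<psi>] conjI)
  qed
  with cut lower pascal_array_Y_TL show ?thesis by blast
qed

end
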